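(* Let $\kappa$ be an uncountable cardinal. Assume that $\mathbb{Q}^1_\kappa$ collapses $2^\kappa$ to $\omega$, that $\mathrm{cf}(\kappa) > \omega$, and that $2^{(\kappa^{<\kappa})} = 2^\kappa$. Then forcing with $\mathbb{Q}^2_\kappa$ collapses $2^\kappa$ to $\aleph_0$.
   Context: Conventions: in a forcing order $(\mathbb{P},\leq_{\mathbb{P}})$, $p \leq_{\mathbb{P}} q$ means that $q$ is stronger than $p$. "$\mathbb{P}$ forces $\varphi$" means the weakest condition forces $\varphi$. "$\mathbb{P}$ collapses $\lambda$ to $\theta$" means that $\mathbb{P}$ forces $|\check\lambda| = \theta$; $2^\kappa$ is computed in the ground model. ${}^{\kappa>}\kappa$ is the set of functions $f\colon\alpha\to\kappa$ with $\alpha<\kappa$ (for such $f$, $\alpha$ is the length of $f$), $\trianglelefteq$ is end extension of such functions, $t^\frown\langle i\rangle = t\cup\{(\mathrm{dom}(t),i)\}$, and $[\kappa]^\kappa$ is the set of subsets of $\kappa$ of size $\kappa$. $\mathbb{Q}^1_\kappa$ is the forcing $([\kappa]^\kappa,\supseteq)$ (smaller sets are stronger; the weakest condition is $\kappa$). $\mathbb{Q}^2_\kappa$ ($\kappa$-Miller forcing): conditions are (nonempty, closed under initial segments) trees $T\subseteq {}^{\kappa>}\kappa$ such that (i) for each $s\in T$ there is $t\in T$ with $s\trianglelefteq t$ that is a $\kappa$-splitting node of $T$, i.e., $\{i<\kappa : t^\frown\langle i\rangle\in T\}$ has size $\kappa$; (ii) the limit (union) of any sequence of length less than $\kappa$ of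 $\kappa$-splitting nodes of $T$ that is increasing in the tree order is a $\kappa$-splitting node of $T$, provided this limit has length less than $\kappa$. The order is $p\leq q$ iff $q\subseteq p$ (subtrees are stronger; the weakest condition is ${}^{\kappa>}\kappa$). *)

theory Defs
  imports Main
begin

unbundle cardinal_syntax

section \<open>Forcing\<close>

text \<open>
  \<^term>\<open>weaker F p q\<close> means that \<^term>\<open>q\<close> is a stronger condition than \<^term>\<open>p\<close>
  (stronger conditions are larger).
\<close>

record 'p forcing =
  conds :: "'p set"
  weaker :: "'p \<Rightarrow> 'p \<Rightarrow> bool"
  weakest :: 'p

definition forcing_order :: "'p forcing \<Rightarrow> bool" where
  "forcing_order F \<longleftrightarrow>
     weakest F \<in> conds F \<and>
     (\<forall>p\<in>conds F. weaker F (weakest F) p) \<and>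
     (\<forall>p\<in>conds F. weaker F p p) \<and>
     (\<forall>p\<in>conds F. \<forall>q\<in>conds F. \<forall>r\<in>conds F.
        weaker F p q \<longrightarrow> weaker F q r \<longrightarrow> weaker F p r)"

text \<open>
  A sentence of the forcing language is represented by the predicate ``\<open>p\<close> forces the
  sentence''. The operations below are the clauses of the usual recursive definition of
  the forcing relation, so nested applications of them spell out the forcing relation for
  the corresponding formula.

  The names that are needed are names for subsets of a check set \<open>X\<close> (the canonical
  name of a set \<open>X\<close> of the ground model): these are sets \<open>\<tau>\<close> of pairs \<open>(x, s)\<close>
  with \<open>x \<in> X\<close> and \<open>s\<close> a condition, where \<open>x\<close> stands for its own check name.
  For check names the clause ``\<open>p\<close> forces \<open>x = y\<close>'' is just \<open>x = y\<close>, which turns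
  the usual clause for membership in \<open>\<tau>\<close> into \<open>forces_mem\<close>: densely many \<open>r\<close> above
  \<open>p\<close> are stronger than some \<open>s\<close> with \<open>(x, s) \<in> \<tau>\<close>.
\<close>

type_synonym 'p sentence = "'p \<Rightarrow> bool"

definition subset_names :: "'p forcing \<Rightarrow> 'x set \<Rightarrow> ('x \<times> 'p) set set" where
  "subset_names F X = Pow (X \<times> conds F)"

definition forces_mem :: "'p forcing \<Rightarrow> 'x \<Rightarrow> ('x \<times> 'p) set \<Rightarrow> 'p sentence" where
  "forces_mem F x \<tau> p \<longleftrightarrow>
     (\<forall>q\<in>conds F. weaker F p q \<longrightarrow>
        (\<exists>r\<in>conds F. weaker F q r \<and> (\<exists>s. (x, s) \<in> \<tau> \<and> weaker F s r)))"

definition forces_eq :: "'x \<Rightarrow> 'x \<Rightarrow> 'p sentence" where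
  "forces_eq x y p \<longleftrightarrow> x = y"

definition forces_not :: "'p forcing \<Rightarrow> 'p sentence \<Rightarrow> 'p sentence" where
  "forces_not F \<phi> p \<longleftrightarrow> (\<forall>q\<in>conds F. weaker F p q \<longrightarrow> \<not> \<phi> q)"

definition forces_and :: "'p sentence \<Rightarrow> 'p sentence \<Rightarrow> 'p sentence" where
  "forces_and \<phi> \<psi> p \<longleftrightarrow> \<phi> p \<and> \<psi> p"

definition forces_imp :: "'p forcing \<Rightarrow> 'p sentence \<Rightarrow> 'p sentence \<Rightarrow> 'p sentence" where
  "forces_imp F \<phi> \<psi> = forces_not F (forces_and \<phi> (forces_not F \<psi>))"

text \<open>
  In the quantifier clauses \<open>D\<close> is the range of the quantifier: either the elements of a
  check set, or the names for its subsets.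
\<close>

definition forces_all :: "'d set \<Rightarrow> ('d \<Rightarrow> 'p sentence) \<Rightarrow> 'p sentence" where
  "forces_all D \<phi> p \<longleftrightarrow> (\<forall>d\<in>D. \<phi> d p)"

definition forces_ex :: "'p forcing \<Rightarrow> 'd set \<Rightarrow> ('d \<Rightarrow> 'p sentence) \<Rightarrow> 'p sentence" where
  "forces_ex F D \<phi> p \<longleftrightarrow>
     (\<forall>q\<in>conds F. weaker F p q \<longrightarrow>
        (\<exists>r\<in>conds F. weaker F q r \<and> (\<exists>d\<in>D. \<phi> d r)))"

definition forces_total ::
  "'p forcing \<Rightarrow> 'a set \<Rightarrow> 'b set \<Rightarrow> (('a \<times> 'b) \<times> 'p) set \<Rightarrow> 'p sentence" where
  "forces_total F A B \<tau> =
     forces_all A (\<lambda>x. forces_ex F B (\<lambda>y. forces_mem F (x, y) \<tau>))"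

definition forces_single_valued ::
  "'p forcing \<Rightarrow> 'a set \<Rightarrow> 'b set \<Rightarrow> (('a \<times> 'b) \<times> 'p) set \<Rightarrow> 'p sentence" where
  "forces_single_valued F A B \<tau> =
     forces_all A (\<lambda>x. forces_all B (\<lambda>y. forces_all B (\<lambda>y'.
       forces_imp F (forces_and (forces_mem F (x, y) \<tau>) (forces_mem F (x, y') \<tau>))
         (forces_eq y y'))))"

definition forces_injective ::
  "'p forcing \<Rightarrow> 'a set \<Rightarrow> 'b set \<Rightarrow> (('a \<times> 'b) \<times> 'p) set \<Rightarrow> 'p sentence" where
  "forces_injective F A B \<tau> =
     forces_all A (\<lambda>x. forces_all A (\<lambda>x'. forces_all B (\<lambda>y.
       forces_imp F (forces_and (forces_mem F (x, y) \<tau>) (forces_mem F (x', y) \<tau>))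
         (forces_eq x x'))))"

definition forces_surjective ::
  "'p forcing \<Rightarrow> 'a set \<Rightarrow> 'b set \<Rightarrow> (('a \<times> 'b) \<times> 'p) set \<Rightarrow> 'p sentence" where
  "forces_surjective F A B \<tau> =
     forces_all B (\<lambda>y. forces_ex F A (\<lambda>x. forces_mem F (x, y) \<tau>))"

definition forces_bijection ::
  "'p forcing \<Rightarrow> 'a set \<Rightarrow> 'b set \<Rightarrow> (('a \<times> 'b) \<times> 'p) set \<Rightarrow> 'p sentence" where
  "forces_bijection F A B \<tau> =
     forces_and (forces_and (forces_total F A B \<tau>) (forces_single_valued F A B \<tau>))
       (forces_and (forces_injective F A B \<tau>) (forces_surjective F A B \<tau>))"

definition forces_equinumerous :: "'p forcing \<Rightarrow> 'a set \<Rightarrow> 'b set \<Rightarrow> 'p sentence" where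
  "forces_equinumerous F A B =
     forces_ex F (subset_names F (A \<times> B)) (\<lambda>\<tau>. forces_bijection F A B \<tau>)"

text \<open>
  The weakest condition forces \<open>|\<lambda>| = \<omega>\<close>. Since \<open>\<omega>\<close> is a cardinal in every extension,
  this says that there is a bijection between \<open>\<lambda>\<close> and \<open>\<omega>\<close> in the extension.
\<close>

definition collapses_to_omega :: "'p forcing \<Rightarrow> 'l rel \<Rightarrow> bool" where
  "collapses_to_omega F l \<longleftrightarrow> forces_equinumerous F (Field l) (UNIV :: nat set) (weakest F)"


section \<open>Cardinals and sequences\<close>

text \<open>
  A cardinal \<open>\<kappa>\<close> is a cardinal order \<^term>\<open>r\<close> in the sense of \<^const>\<open>Card_order\<close>. The
  ordinals below \<open>\<kappa>\<close> are the elements \<open>a\<close> of \<^term>\<open>Field r\<close>, the von Neumann ordinal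
  \<open>a\<close> being the set \<^term>\<open>underS r a\<close> of its strict predecessors.
\<close>

text \<open>The least cardinality of a cofinal subset.\<close>

definition cofinality :: "'a rel \<Rightarrow> 'a rel" where
  "cofinality r = |SOME A. A \<subseteq> Field r \<and> cofinal A r \<and>
                     (\<forall>B. B \<subseteq> Field r \<and> cofinal B r \<longrightarrow> |A| \<le>o |B| )|"

lemma least_cofinality:
  assumes "Card_order r" "infinite (Field r)"
  shows "\<exists>A. A \<subseteq> Field r \<and> cofinal A r \<and> |A| =o cofinality r \<and>
           (\<forall>B. B \<subseteq> Field r \<and> cofinal B r \<longrightarrow> cofinality r \<le>o |B| )"
proof -
  let ?R = "{ |A| | A. A \<subseteq> Field r \<and> cofinal A r}"
  have "cofinal (Field r) r"
    using infinite_Card_order_limit[OF assms] unfolding cofinal_def by blast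
  then have "?R \<noteq> {}" by blast
  moreover have "\<forall>c\<in>?R. Well_order c" by (auto simp: card_of_Well_order)
  ultimately have "\<exists>c\<in>?R. \<forall>c'\<in>?R. c \<le>o c'"
    by (rule exists_minim_Well_order)
  then have "\<exists>A. A \<subseteq> Field r \<and> cofinal A r \<and> (\<forall>B. B \<subseteq> Field r \<and> cofinal B r \<longrightarrow> |A| \<le>o |B| )"
    by blast
  from someI_ex[OF this] show ?thesis
    unfolding cofinality_def by (blast intro: card_of_refl)
qed

text \<open>
  The functions \<open>f : \<alpha> \<rightarrow> \<kappa>\<close> with \<open>\<alpha> < \<kappa>\<close>, as partial functions; end extension of such
  functions is \<^term>\<open>(\<subseteq>\<^sub>m)\<close>.
\<close>

definition seqs :: "'a rel \<Rightarrow> ('a \<rightharpoonup> 'a) set" where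
  "seqs r = {f. (\<exists>a\<in>Field r. dom f = underS r a) \<and> ran f \<subseteq> Field r}"

definition seq_length :: "'a rel \<Rightarrow> ('a \<rightharpoonup> 'a) \<Rightarrow> 'a" where
  "seq_length r f = (THE a. a \<in> Field r \<and> dom f = underS r a)"

definition seq_snoc :: "'a rel \<Rightarrow> ('a \<rightharpoonup> 'a) \<Rightarrow> 'a \<Rightarrow> ('a \<rightharpoonup> 'a)" where
  "seq_snoc r t i = t(seq_length r t \<mapsto> i)"


section \<open>The two forcing orders\<close>

definition subset_forcing :: "'a rel \<Rightarrow> 'a set forcing" where
  "subset_forcing r =
     \<lparr>conds = {A. A \<subseteq> Field r \<and> |A| =o r},
      weaker = (\<lambda>A B. B \<subseteq> A),
      weakest = Field r\<rparr>"

definition seq_tree :: "'a rel \<Rightarrow> ('a \<rightharpoonup> 'a) set \<Rightarrow> bool" where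
  "seq_tree r T \<longleftrightarrow>
     T \<noteq> {} \<and> T \<subseteq> seqs r \<and> (\<forall>t\<in>T. \<forall>s\<in>seqs r. s \<subseteq>\<^sub>m t \<longrightarrow> s \<in> T)"

definition splitting_node :: "'a rel \<Rightarrow> ('a \<rightharpoonup> 'a) set \<Rightarrow> ('a \<rightharpoonup> 'a) \<Rightarrow> bool" where
  "splitting_node r T t \<longleftrightarrow> t \<in> T \<and> |{i \<in> Field r. seq_snoc r t i \<in> T}| =o r"

text \<open>
  In the closure condition, \<open>s\<close> is a sequence whose length is the ordinal \<open>b < \<kappa>\<close>. The
  empty sequence is excluded: the closure condition is about limits of splitting nodes and
  does not require the root to be splitting. The union \<open>u\<close> of the sequence is described by its
  graph, and \<open>u \<in> seqs r\<close> is the proviso that the union has length less than \<open>\<kappa>\<close>.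
\<close>

definition miller_tree :: "'a rel \<Rightarrow> ('a \<rightharpoonup> 'a) set \<Rightarrow> bool" where
  "miller_tree r T \<longleftrightarrow>
     seq_tree r T \<and>
     (\<forall>s\<in>T. \<exists>t\<in>T. s \<subseteq>\<^sub>m t \<and> splitting_node r T t) \<and>
     (\<forall>b\<in>Field r. \<forall>s. \<forall>u\<in>seqs r.
        underS r b \<noteq> {} \<longrightarrow>
        (\<forall>c\<in>underS r b. splitting_node r T (s c)) \<longrightarrow>
        (\<forall>c\<in>underS r b. \<forall>d\<in>underS r b. (c, d) \<in> r \<longrightarrow> s c \<subseteq>\<^sub>m s d) \<longrightarrow>
        Map.graph u = (\<Union>c\<in>underS r b. Map.graph (s c)) \<longrightarrow>
        splitting_node r T u)"

definition miller_forcing :: "'a rel \<Rightarrow> ('a \<rightharpoonup> 'a) set forcing" where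
  "miller_forcing r =
     \<lparr>conds = {T. miller_tree r T},
      weaker = (\<lambda>S T. T \<subseteq> S),
      weakest = seqs r\<rparr>"

lemma forcing_order_subset_forcing:
  assumes "Card_order r"
  shows "forcing_order (subset_forcing r)"
  using card_of_Field_ordIso[OF assms]
  by (auto simp: forcing_order_def subset_forcing_def)

lemma underS_inj:
  assumes "Well_order r" "a \<in> Field r" "b \<in> Field r" "underS r a = underS r b"
  shows "a = b"
proof -
  interpret wo_rel r using assms by (simp add: wo_rel_def)
  show ?thesis using assms TOTALS by (auto simp: underS_def)
qed

lemma seq_length_eq:
  assumes "Well_order r" "a \<in> Field r" "dom f = underS r a"
  shows "seq_length r f = a"
  unfolding seq_length_def using assms underS_inj[OF assms(1)] by (intro the_equality) auto

lemma ex_successor: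
  assumes "Card_order r" "infinite (Field r)" "a \<in> Field r"
  shows "\<exists>b\<in>Field r. underS r b = insert a (underS r a)"
proof -
  interpret wo_rel r using assms by (simp add: wo_rel_def card_order_on_well_order_on)
  have ne: "AboveS {a} \<noteq> {}"
    using infinite_Card_order_limit[OF assms] assms(3) by (auto simp: AboveS_def FieldI2)
  let ?b = "suc {a}"
  have b: "?b \<in> AboveS {a}" using suc_AboveS[of "{a}"] ne assms(3) by auto
  then have bF: "?b \<in> Field r" and ab: "(a, ?b) \<in> r" "a \<noteq> ?b" by (auto simp: AboveS_def)
  have "x \<in> insert a (underS a)" if x: "(x, ?b) \<in> r" "x \<noteq> ?b" for x
  proof (rule ccontr)
    assume n: "x \<notin> insert a (underS a)"
    have xF: "x \<in> Field r" using x by (auto simp: FieldI1)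
    have "(a, x) \<in> r" using n TOTALS xF assms(3) by (auto simp: underS_def)
    then have "x \<in> AboveS {a}" using n xF by (auto simp: AboveS_def)
    then have "(?b, x) \<in> r" using suc_least_AboveS by blast
    then show False using x ANTISYM by (auto simp: antisym_def)
  qed
  moreover have "x \<in> underS ?b" if "x \<in> insert a (underS a)" for x
    using that ab TRANS ANTISYM unfolding underS_def
    by (auto dest: transD antisymD)
  ultimately have "underS ?b = insert a (underS a)" by (auto simp: underS_def)
  with bF show ?thesis by blast
qed

lemma seq_snoc_in_seqs:
  assumes "Card_order r" "infinite (Field r)" "t \<in> seqs r" "i \<in> Field r"
  shows "seq_snoc r t i \<in> seqs r"
proof -
  from assms(3) obtain a where a: "a \<in> Field r" "dom t = underS r a" and ran: "ran t \<subseteq> Field r"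
    unfolding seqs_def by blast
  have len: "seq_length r t = a"
    using seq_length_eq[OF _ a] assms(1) card_order_on_well_order_on by blast
  obtain b where b: "b \<in> Field r" "underS r b = insert a (underS r a)"
    using ex_successor[OF assms(1,2) a(1)] by blast
  have "dom (t(a \<mapsto> i)) = underS r b" using a(2) b(2) by simp
  moreover have "ran (t(a \<mapsto> i)) \<subseteq> Field r"
    using ran assms(4) by (auto simp: ran_def)
  ultimately show ?thesis
    using b(1) unfolding seqs_def seq_snoc_def len by blast
qed

lemma splitting_node_seqs:
  assumes "Card_order r" "infinite (Field r)" "t \<in> seqs r"
  shows "splitting_node r (seqs r) t"
proof -
  have "{i \<in> Field r. seq_snoc r t i \<in> seqs r} = Field r"
    using seq_snoc_in_seqs[OF assms] by auto
  then show ?thesis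
    using assms(3) card_of_Field_ordIso[OF assms(1)] by (simp add: splitting_node_def)
qed

lemma forcing_order_miller_forcing:
  assumes "Card_order r" "infinite (Field r)"
  shows "forcing_order (miller_forcing r)"
proof -
  have W: "Well_order r" using assms(1) card_order_on_well_order_on by blast
  interpret wo_rel r using W by (simp add: wo_rel_def)
  have "Field r \<noteq> {}" using assms(2) by auto
  then have "underS (minim (Field r)) = {}" "minim (Field r) \<in> Field r"
    using minim_least[of "Field r"] minim_in[of "Field r"] ANTISYM
    by (auto simp: underS_def antisym_def dest: FieldI1)
  then have "Map.empty \<in> seqs r" by (auto simp: seqs_def intro!: bexI[of _ "minim (Field r)"])
  then have "miller_tree r (seqs r)"
    using splitting_node_seqs[OF assms] unfolding miller_tree_def seq_tree_def
    by (auto intro: map_le_refl)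
  moreover have "T \<subseteq> seqs r" if "miller_tree r T" for T
    using that by (auto simp: miller_tree_def seq_tree_def)
  ultimately show ?thesis
    by (auto simp: forcing_order_def miller_forcing_def)
qed

end

theory Submission
  imports Defs
begin

text \<open>
  Let \<open>L = 2\<^sup>\<kappa>\<close>. A name for a bijection between \<open>L\<close> and \<open>\<omega>\<close> in the first forcing makes it
  possible to shrink any family \<open>(a\<^sub>\<xi>)\<close>, \<open>\<xi> < L\<close>, of sets in \<open>[\<kappa>]\<^sup>\<kappa>\<close> to sets \<open>d\<^sub>\<xi>\<close> such that each \<open>d\<^sub>\<xi>\<close> is
  almost disjoint from all but finitely many \<open>d\<^sub>\<zeta>\<close>, \<open>\<zeta> < \<xi>\<close>. By the assumption on \<open>seqs \<kappa>\<close>, the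
  pairs of a Miller tree and an ordinal below \<open>L\<close> can be listed as \<open>(T\<^sub>\<xi>, \<alpha>\<^sub>\<xi>)\<close>, \<open>\<xi> < L\<close>. Applying the
  shrinking at every node to the successor sets of the \<open>T\<^sub>\<xi>\<close> yields subtrees such that at each
  node only finitely many earlier trees have a large overlap with a given one. Consequently a tree
  can be shrunk further so that it is contained in or incompatible with each of the earlier trees:
  otherwise one gets a descending \<open>\<omega>\<close>-sequence of trees, each below a new earlier tree, together with
  an increasing sequence of splitting nodes, whose limit (of length less than \<open>\<kappa>\<close> as \<open>cf \<kappa> > \<omega>\<close>) is a
  splitting node of all the trees and hence has infinitely many large overlaps. In the resulting
  family \<open>(R\<^sub>\<xi>)\<close> each tree lies below only finitely many, say \<open>m\<^sub>\<xi>\<close>, earlier ones, and trees with the same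
  \<open>m\<^sub>\<xi>\<close> are incompatible. So \<open>m\<^sub>\<xi> \<mapsto> \<alpha>\<^sub>\<xi>\<close> for \<open>R\<^sub>\<xi>\<close> in the generic filter is a partial function from \<open>\<omega>\<close>
  onto \<open>L\<close>.
\<close>

section \<open>Collapsing to \<open>\<omega>\<close>\<close>

lemma forces_mem_mono:
  assumes "forcing_order F" "forces_mem F x \<tau> p" "weaker F p q" "p \<in> conds F" "q \<in> conds F"
  shows "forces_mem F x \<tau> q"
  using assms unfolding forces_mem_def forcing_order_def by blast

text \<open>Every condition treats \<open>x = y\<close> alike, so the inner negation in
  \<open>forces_imp\<close> just says \<open>x \<noteq> y\<close> and no further extension has to be
  considered.\<close>

lemma forces_imp_eq_iff:
  assumes "forcing_order F"
  shows "forces_imp F \<phi> (forces_eq x y) p \<longleftrightarrow>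
    (\<forall>q\<in>conds F. weaker F p q \<longrightarrow> \<phi> q \<longrightarrow> x = y)"
  using assms unfolding forces_imp_def forces_not_def forces_and_def forces_eq_def forcing_order_def
  by blast

text \<open>Extending \<open>p\<close> twice catches first a pair for \<open>x\<close>, then one for
  \<open>y\<close>. This turns forced membership into a statement about actual elements of the
  name.\<close>

lemma forces_mem_common:
  assumes F: "forcing_order F" and \<tau>: "\<tau> \<in> subset_names F X" and p: "p \<in> conds F"
    and x: "forces_mem F x \<tau> p" and y: "forces_mem F y \<tau> p"
  obtains q s t where "q \<in> conds F" "(x, s) \<in> \<tau>" "(y, t) \<in> \<tau>" "weaker F s q" "weaker F t q"
proof -
  have trans: "weaker F u w" if "weaker F u v" "weaker F v w" "u \<in> conds F" "v \<in> conds F" "w \<in> conds F"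
    for u v w using F that unfolding forcing_order_def by blast
  have refl: "weaker F p p" using F p unfolding forcing_order_def by blast
  obtain q1 s where 1: "q1 \<in> conds F" "weaker F p q1" "(x, s) \<in> \<tau>" "weaker F s q1"
    using x refl p unfolding forces_mem_def by blast
  obtain q2 t where 2: "q2 \<in> conds F" "weaker F q1 q2" "(y, t) \<in> \<tau>" "weaker F t q2"
    using y 1 unfolding forces_mem_def by blast
  have "s \<in> conds F" using \<tau> 1 by (auto simp: subset_names_def)
  with 1 2 trans show ?thesis by (intro that[of q2 s t]) blast+
qed

text \<open>For \<open>q i\<close> in the generic filter, \<open>coherent\<close> makes the
  assignment \<open>m i \<mapsto> lab i\<close> single-valued and \<open>dense\<close> makes it onto
  \<open>L\<close>. It may be partial and repeat values, so the bijection lists the elements of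
  \<open>L\<close> in the order of their first appearance.\<close>

lemma forces_equinumerous_natI:
  fixes m :: "'i \<Rightarrow> nat"
  assumes F: "forcing_order F" and inf: "infinite L"
    and q: "\<And>i. i \<in> I \<Longrightarrow> q i \<in> conds F" and lab: "\<And>i. i \<in> I \<Longrightarrow> lab i \<in> L"
    and coherent: "\<And>i j p. \<lbrakk>i \<in> I; j \<in> I; m i = m j; p \<in> conds F; weaker F (q i) p; weaker F (q j) p\<rbrakk>
      \<Longrightarrow> lab i = lab j"
    and dense: "\<And>p x. \<lbrakk>p \<in> conds F; x \<in> L\<rbrakk> \<Longrightarrow> \<exists>i\<in>I. lab i = x \<and> weaker F p (q i)"
  shows "forces_equinumerous F L (UNIV :: nat set) (weakest F)"
proof -
  have trans: "weaker F u w" if "weaker F u v" "weaker F v w" "u \<in> conds F" "v \<in> conds F" "w \<in> conds F"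
    for u v w using F that unfolding forcing_order_def by blast
  have refl: "weaker F p p" if "p \<in> conds F" for p using F that unfolding forcing_order_def by blast
  define val where "val p k x \<longleftrightarrow> (\<exists>i\<in>I. m i = k \<and> lab i = x \<and> weaker F (q i) p)" for p k x
  define vals where "vals p M = {x. \<exists>j<M. val p j x}" for p M
  \<comment> \<open>An argument also counts as decided when no extension can give it a value. Thus
    \<open>dec p M\<close> makes \<open>vals p M\<close> final: extensions of \<open>p\<close> do
    not change it.\<close>
  define dec where "dec p M \<longleftrightarrow> (\<forall>j<M. (\<exists>x. val p j x) \<or>
    (\<forall>p'\<in>conds F. weaker F p p' \<longrightarrow> (\<forall>x. \<not> val p' j x)))" for p M
  have val_unique: "x = y" if "val p k x" "val p k y" "p \<in> conds F" for p k x y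
    using that coherent unfolding val_def by metis
  have val_mono: "val p' k x" if "val p k x" "weaker F p p'" "p \<in> conds F" "p' \<in> conds F" for p p' k x
    using that trans q unfolding val_def by blast
  have val_L: "x \<in> L" if "val p k x" for p k x
    using that lab unfolding val_def by blast
  have dec_mono: "dec p' M" if "dec p M" "weaker F p p'" "p \<in> conds F" "p' \<in> conds F" for p p' M
    using that val_mono trans unfolding dec_def by meson
  have dec_le: "dec p M" if "dec p N" "M \<le> N" for p M N
    using that unfolding dec_def by auto
  have vals_eq: "vals p' M = vals p M" if "dec p M" "weaker F p p'" "p \<in> conds F" "p' \<in> conds F" for p p' M
    using that val_mono val_unique unfolding vals_def dec_def by blast
  have finite_vals: "finite (vals p M)" if "p \<in> conds F" for p M
  proof (induction M)
    case 0 show ?case by (simp add: vals_def)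
  next
    case (Suc M)
    have "finite {x. val p M x}"
      using val_unique that by (metis (mono_tags, lifting) finite.simps is_singletonI' is_singleton_def mem_Collect_eq)
    moreover have "vals p (Suc M) = vals p M \<union> {x. val p M x}"
      by (auto simp: vals_def less_Suc_eq)
    ultimately show ?case using Suc by simp
  qed
  have ex_dec: "\<exists>p'\<in>conds F. weaker F p p' \<and> dec p' M" if "p \<in> conds F" for p M
    using that
  proof (induction M)
    case 0 then show ?case using refl by (auto simp: dec_def)
  next
    case (Suc M)
    then obtain p1 where p1: "p1 \<in> conds F" "weaker F p p1" "dec p1 M" by blast
    \<comment> \<open>Either some extension gives \<open>M\<close> a value, or none does and
      \<open>p1\<close> has already decided that \<open>M\<close> stays undefined.\<close>
    show ?case
    proof (cases "\<exists>p2\<in>conds F. weaker F p1 p2 \<and> (\<exists>x. val p2 M x)")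
      case True
      then obtain p2 where p2: "p2 \<in> conds F" "weaker F p1 p2" "\<exists>x. val p2 M x" by blast
      then have "dec p2 M" using dec_mono p1 by blast
      with p2 have "dec p2 (Suc M)" by (auto simp: dec_def less_Suc_eq)
      with p1 p2 Suc.prems trans show ?thesis by blast
    next
      case False
      with p1 have "dec p1 (Suc M)" by (auto simp: dec_def less_Suc_eq)
      with p1 show ?thesis by blast
    qed
  qed
  \<comment> \<open>The conditions \<open>q i\<close> in the generic filter define a partial surjection \<open>m i \<mapsto> lab i\<close> from \<open>\<omega>\<close>
    onto \<open>L\<close>; sending \<open>x\<close> to the number of values taken before \<open>x\<close> turns it into a bijection.\<close>
  define new where "new p x k \<longleftrightarrow>
    (\<exists>M. dec p M \<and> val p M x \<and> x \<notin> vals p M \<and> card (vals p M) = k)" for p x k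
  have new_mono: "new p' x k" if "new p x k" "weaker F p p'" "p \<in> conds F" "p' \<in> conds F" for p p' x k
    using that dec_mono val_mono vals_eq unfolding new_def by metis
  have new_single: "k = k'" if "new p x k" "new p x k'" for p x k k'
    using that unfolding new_def vals_def by (metis (mono_tags, lifting) mem_Collect_eq not_less_iff_gr_or_eq)
  \<comment> \<open>A value new at \<open>M\<close> belongs to every later \<open>vals p N\<close>,
    so the count strictly grows after \<open>M\<close>. Hence a rank determines the argument where
    it is attained.\<close>
  have new_less: False if "p \<in> conds F" "val p M x" "x \<notin> vals p M" "M < N" "card (vals p M) = card (vals p N)" for p M N x
  proof -
    have "insert x (vals p M) \<subseteq> vals p N"
      using that unfolding vals_def by (auto intro: less_trans)
    then have "card (insert x (vals p M)) \<le> card (vals p N)"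
      using finite_vals[OF that(1)] card_mono by blast
    with that finite_vals show False by simp
  qed
  have new_inj: "x = y" if p: "p \<in> conds F" and xy: "new p x k" "new p y k" for p x y k
  proof -
    obtain M where M: "val p M x" "x \<notin> vals p M" "card (vals p M) = k"
      using xy unfolding new_def by blast
    obtain N where N: "val p N y" "y \<notin> vals p N" "card (vals p N) = k"
      using xy unfolding new_def by blast
    have "M = N" using new_less[OF p] M N by (metis nat_neq_iff)
    then show ?thesis using M N val_unique p by blast
  qed
  have new_total: "\<exists>p'\<in>conds F. weaker F p p' \<and> (\<exists>k. new p' x k)" if p: "p \<in> conds F" and x: "x \<in> L" for p x
  proof -
    obtain i where i: "i \<in> I" "lab i = x" "weaker F p (q i)" using dense p x by blast
    have qi: "q i \<in> conds F" using i q by blast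
    obtain p' where p': "p' \<in> conds F" "weaker F (q i) p'" "dec p' (m i)" using ex_dec[OF qi] by blast
    have v: "val p' (m i) x" using i p' by (auto simp: val_def)
    \<comment> \<open>\<open>m i\<close> need not be the first argument with value \<open>x\<close>.
      The rank of \<open>x\<close> is counted at the least one, and \<open>M \<le> m i\<close> keeps
      everything below it decided.\<close>
    define M where "M = (LEAST M. val p' M x)"
    have M: "val p' M x" "M \<le> m i" unfolding M_def using v by (auto intro: LeastI Least_le)
    have "x \<notin> vals p' M" unfolding vals_def M_def using not_less_Least by blast
    then have "new p' x (card (vals p' M))" using M dec_le p' unfolding new_def by blast
    then show ?thesis using p' i p qi trans by blast
  qed
  have new_next: "\<exists>p'\<in>conds F. weaker F p p' \<and>
      (\<exists>N x. dec p' (Suc N) \<and> val p' N x \<and> x \<notin> vals p' N \<and> vals p' N = vals p M)"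
    if p: "p \<in> conds F" and d: "dec p M" for p M
  proof -
    \<comment> \<open>Finitely many values are taken below \<open>M\<close> and \<open>L\<close> is
      infinite, so density can supply a value outside \<open>vals p M\<close>.\<close>
    obtain y where y: "y \<in> L" "y \<notin> vals p M" using finite_vals[OF p, of M] inf
      by (meson finite_subset subsetI)
    obtain i where i: "i \<in> I" "lab i = y" "weaker F p (q i)" using dense p y by blast
    have qi: "q i \<in> conds F" using i q by blast
    obtain p' where p': "p' \<in> conds F" "weaker F (q i) p'" "dec p' (Suc (m i))" using ex_dec[OF qi] by blast
    have pp': "weaker F p p'" using p' i p qi trans by blast
    have v: "\<exists>x. x \<notin> vals p M \<and> val p' (m i) x" using i p' y by (auto simp: val_def)
    \<comment> \<open>By minimality no value is added before \<open>N\<close>, so exactly one is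
      added at \<open>N\<close>. Deciding up to \<open>Suc (m i)\<close> ensures that the argument
      \<open>N\<close> itself is decided.\<close>
    define N where "N = (LEAST N. \<exists>x. x \<notin> vals p M \<and> val p' N x)"
    have N: "\<exists>x. x \<notin> vals p M \<and> val p' N x" "N \<le> m i"
      unfolding N_def using v by (auto intro: LeastI Least_le)
    then obtain x where x: "x \<notin> vals p M" "val p' N x" by blast
    have veq: "vals p' M = vals p M" using vals_eq d pp' p p' by blast
    have "M \<le> N" using x veq unfolding vals_def by (metis (mono_tags, lifting) linorder_not_le mem_Collect_eq)
    then have "vals p' M \<subseteq> vals p' N" unfolding vals_def using less_le_trans by blast
    moreover have "y \<in> vals p M" if "j < N" "val p' j y" for j y
      using not_less_Least[of j "\<lambda>N. \<exists>x. x \<notin> vals p M \<and> val p' N x"] that by (auto simp: N_def)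
    then have "vals p' N \<subseteq> vals p M" by (auto simp: vals_def[of p' N])
    ultimately have "vals p' N = vals p M" using veq by simp
    moreover have "dec p' (Suc N)" using dec_le p'(3) N(2) by simp
    ultimately show ?thesis using x p' pp' by auto
  qed
  \<comment> \<open>Induction on \<open>k\<close>: each use of \<open>new_next\<close> raises the
    number of values by exactly one, so no rank is skipped.\<close>
  have rank: "\<exists>p'\<in>conds F. weaker F p p' \<and> (\<exists>M. dec p' M \<and> card (vals p' M) = k)" if p: "p \<in> conds F" for p k
    using p
  proof (induction k)
    case 0
    have "dec p 0" "vals p 0 = {}" by (auto simp: dec_def vals_def)
    then show ?case using 0 refl by (metis card.empty)
  next
    case (Suc k)
    then obtain p1 M where p1: "p1 \<in> conds F" "weaker F p p1" "dec p1 M" "card (vals p1 M) = k" by blast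
    obtain p2 N x where p2: "p2 \<in> conds F" "weaker F p1 p2" "dec p2 (Suc N)" "val p2 N x"
      "x \<notin> vals p2 N" "vals p2 N = vals p1 M" using new_next[OF p1(1,3)] by blast
    have "vals p2 (Suc N) = insert x (vals p2 N)"
      using val_unique p2 by (auto simp: vals_def less_Suc_eq)
    then have "card (vals p2 (Suc N)) = Suc k" using p2 p1 finite_vals by simp
    then show ?case using p2 p1 trans Suc.prems by blast
  qed
  have new_surj: "\<exists>p'\<in>conds F. weaker F p p' \<and> (\<exists>x\<in>L. new p' x k)" if p: "p \<in> conds F" for p k
  proof -
    obtain p1 M where p1: "p1 \<in> conds F" "weaker F p p1" "dec p1 M" "card (vals p1 M) = k"
      using rank[OF p] by blast
    obtain p2 N x where p2: "p2 \<in> conds F" "weaker F p1 p2" "dec p2 (Suc N)" "val p2 N x"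
      "x \<notin> vals p2 N" "vals p2 N = vals p1 M" using new_next[OF p1(1,3)] by blast
    have "dec p2 N" using dec_le p2 by force
    then have "new p2 x k" unfolding new_def using p2(4-6) p1(4) by (intro exI[of _ N]) simp
    moreover have "weaker F p p2" using trans[OF p1(2) p2(2) p p1(1) p2(1)] .
    ultimately show ?thesis using p2(1) val_L[OF p2(4)] by blast
  qed
  define \<tau> where "\<tau> = {((x, k), p). x \<in> L \<and> p \<in> conds F \<and> new p x k}"
  have \<tau>: "\<tau> \<in> subset_names F (L \<times> UNIV)" by (auto simp: \<tau>_def subset_names_def)
  have mem: "forces_mem F (x, k) \<tau> p" if "x \<in> L" "p \<in> conds F" "new p x k" for x k p
    using that refl unfolding forces_mem_def \<tau>_def by blast
  have common: "\<exists>r\<in>conds F. new r x k \<and> new r y l"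
    if p: "p \<in> conds F" and kl: "forces_mem F (x, k) \<tau> p" "forces_mem F (y, l) \<tau> p" for p x y k l
  proof -
    obtain r s t where "r \<in> conds F" "((x, k), s) \<in> \<tau>" "((y, l), t) \<in> \<tau>" "weaker F s r" "weaker F t r"
      using forces_mem_common[OF F \<tau> p kl] .
    then show ?thesis using new_mono unfolding \<tau>_def by blast
  qed
  have "forces_bijection F L UNIV \<tau> p" if "p \<in> conds F" for p
    unfolding forces_bijection_def forces_and_def forces_total_def forces_single_valued_def
      forces_injective_def forces_surjective_def forces_all_def forces_ex_def forces_imp_eq_iff[OF F]
  proof (intro conjI ballI impI)
    fix x p' assume "x \<in> L" "p' \<in> conds F"
    then show "\<exists>r\<in>conds F. weaker F p' r \<and> (\<exists>k\<in>UNIV. forces_mem F (x, k) \<tau> r)"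
      using new_total[of p' x] mem by blast
  next
    fix x k k' p' assume "x \<in> L" "p' \<in> conds F" "forces_mem F (x, k) \<tau> p' \<and> forces_mem F (x, k') \<tau> p'"
    then show "k = k'" using common[of p'] new_single by blast
  next
    fix x y k p' assume "p' \<in> conds F" "forces_mem F (x, k) \<tau> p' \<and> forces_mem F (y, k) \<tau> p'"
    then show "x = y" using common[of p'] new_inj by blast
  next
    fix k p' assume "p' \<in> conds F"
    then show "\<exists>r\<in>conds F. weaker F p' r \<and> (\<exists>x\<in>L. forces_mem F (x, k) \<tau> r)"
      using new_surj[of p' k] mem by blast
  qed
  then show ?thesis
    unfolding forces_equinumerous_def forces_ex_def using \<tau> refl by blast
qed

section \<open>Almost disjoint refinements\<close>

text \<open>An element of \<open>L\<close> has fewer than \<open>|L|\<close> predecessors, so finite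
  sets indexed by them cannot cover \<open>L\<close>. The finite case is separate because the
  cardinal bound on the union is by an infinite index set.\<close>

lemma ex_notin_UN_underS:
  assumes L: "Card_order L" "infinite (Field L)" and \<xi>: "\<xi> \<in> Field L"
    and fin: "\<And>\<zeta>. \<zeta> \<in> underS L \<xi> \<Longrightarrow> finite (E \<zeta>)"
  shows "\<exists>v\<in>Field L. v \<notin> (\<Union>\<zeta>\<in>underS L \<xi>. E \<zeta>)"
proof (cases "finite (underS L \<xi>)")
  case True
  then have "finite (\<Union>\<zeta>\<in>underS L \<xi>. E \<zeta>)" using fin by blast
  then show ?thesis using L(2) by (meson finite_subset subsetI)
next
  case False
  then have "|E \<zeta>| \<le>o |underS L \<xi>|" if "\<zeta> \<in> underS L \<xi>" for \<zeta>
    using fin[OF that] by (intro ordLess_imp_ordLeq finite_ordLess_infinite)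
      (auto simp: Field_card_of card_of_well_order_on)
  then have "|\<Union>\<zeta>\<in>underS L \<xi>. E \<zeta>| \<le>o |underS L \<xi>|"
    using card_of_UNION_ordLeq_infinite[OF False ordLeq_reflexive[OF card_of_Well_order]] by blast
  then have "|\<Union>\<zeta>\<in>underS L \<xi>. E \<zeta>| <o L"
    using card_of_underS[OF L(1) \<xi>] ordLeq_ordLess_trans by blast
  then have "\<not> Field L \<subseteq> (\<Union>\<zeta>\<in>underS L \<xi>. E \<zeta>)"
    using card_of_Field_ordIso[OF L(1)] card_of_mono1 not_ordLess_ordLeq ordIso_ordLeq_trans
      ordIso_symmetric by metis
  then show ?thesis by blast
qed

text \<open>
  Writing \<open>g : \<omega> \<rightarrow> L\<close> for the inverse of the generic bijection, \<open>d \<xi>\<close> is chosen by recursion so that for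
  some \<open>n\<close> it decides \<open>g\<close> on \<open>{0..n}\<close> and \<open>g n\<close> differs from all the values decided by earlier
  conditions. Then the earlier conditions compatible with \<open>d \<xi>\<close> have different numbers \<open>n\<close>, all of
  them smaller than the one of \<open>d \<xi>\<close>.
\<close>

lemma separated_refinement:
  fixes L :: "'l rel"
  assumes F: "forcing_order F" and L: "Card_order L" "infinite (Field L)"
    and bij: "forces_bijection F (Field L) (UNIV :: nat set) \<tau> p0" and p0: "p0 \<in> conds F"
    and a: "\<And>\<xi>. \<xi> \<in> Field L \<Longrightarrow> a \<xi> \<in> conds F \<and> weaker F p0 (a \<xi>)"
  shows "\<exists>d. \<forall>\<xi>\<in>Field L. d \<xi> \<in> conds F \<and> weaker F (a \<xi>) (d \<xi>) \<and>
    finite {\<zeta> \<in> underS L \<xi>. \<exists>p\<in>conds F. weaker F (d \<zeta>) p \<and> weaker F (d \<xi>) p}"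
proof -
  have W: "Well_order L" using L(1) card_order_on_well_order_on by blast
  note TOTALS = wo_rel.TOTALS[OF wo_rel.intro[OF W]]
  have trans: "weaker F u w" if "weaker F u v" "weaker F v w" "u \<in> conds F" "v \<in> conds F" "w \<in> conds F"
    for u v w using F that unfolding forcing_order_def by blast
  \<comment> \<open>\<open>val p k v\<close> means that \<open>p\<close> forces the generic
    bijection to send \<open>v\<close> to \<open>k\<close>, that is, \<open>g k = v\<close>.\<close>
  define val where "val p k v \<longleftrightarrow> v \<in> Field L \<and> forces_mem F (v, k) \<tau> p" for p k v
  have mono: "val q k v" if "val p k v" "weaker F p q" "p \<in> conds F" "q \<in> conds F" for p q k v
    using that forces_mem_mono[OF F, of "(v, k)" \<tau> p q] by (simp add: val_def)
  have "\<forall>v\<in>Field L. \<forall>w\<in>Field L. \<forall>k. \<forall>p\<in>conds F. weaker F p0 p \<longrightarrow>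
      forces_mem F (v, k) \<tau> p \<and> forces_mem F (w, k) \<tau> p \<longrightarrow> v = w"
    using bij by (simp add: forces_bijection_def forces_and_def forces_injective_def forces_all_def
      forces_imp_eq_iff[OF F])
  then have unique: "v = w" if "val p k v" "val p k w" "p \<in> conds F" "weaker F p0 p" for p k v w
    using that unfolding val_def by blast
  have "\<forall>v\<in>Field L. \<forall>p\<in>conds F. weaker F p0 p \<longrightarrow>
      (\<exists>q\<in>conds F. weaker F p q \<and> (\<exists>k. forces_mem F (v, k) \<tau> q))"
    using bij by (simp add: forces_bijection_def forces_and_def forces_total_def forces_all_def forces_ex_def)
  then have total: "\<exists>q\<in>conds F. weaker F p q \<and> (\<exists>k. val q k v)"
    if "v \<in> Field L" "p \<in> conds F" "weaker F p0 p" for p v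
    using that by (simp add: val_def)
  have "\<forall>k. \<forall>p\<in>conds F. weaker F p0 p \<longrightarrow>
      (\<exists>q\<in>conds F. weaker F p q \<and> (\<exists>v\<in>Field L. forces_mem F (v, k) \<tau> q))"
    using bij by (simp add: forces_bijection_def forces_and_def forces_surjective_def forces_all_def forces_ex_def)
  then have surj: "\<exists>q\<in>conds F. weaker F p q \<and> (\<exists>v. val q k v)"
    if "p \<in> conds F" "weaker F p0 p" for p k
    using that by (simp add: val_def Bex_def)
  have decide: "\<exists>q\<in>conds F. weaker F p q \<and> (\<forall>k\<le>n. \<exists>v. val q k v)"
    if "p \<in> conds F" "weaker F p0 p" for p and n :: nat
  proof (induction n)
    case 0 show ?case using surj[OF that] by auto
  next
    case (Suc n)
    then obtain q where q: "q \<in> conds F" "weaker F p q" "\<forall>k\<le>n. \<exists>v. val q k v" by blast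
    have "weaker F p0 q" using trans q that p0 by blast
    then obtain q' where q': "q' \<in> conds F" "weaker F q q'" "\<exists>v. val q' (Suc n) v"
      using surj q by blast
    then have "\<forall>k\<le>Suc n. \<exists>v. val q' k v" using mono q by (metis le_Suc_eq)
    then show ?case using q q' that trans by blast
  qed
  \<comment> \<open>\<open>f \<zeta>\<close> is the pair of the condition and the number chosen at
    \<open>\<zeta>\<close>. The last clause makes the value at \<open>n\<close> avoid every value
    that an earlier condition decides up to its own number.\<close>
  define P where "P f \<xi> x \<longleftrightarrow> (\<xi> \<in> Field L \<longrightarrow> (case x of (d, n) \<Rightarrow>
     d \<in> conds F \<and> weaker F (a \<xi>) d \<and> (\<forall>k\<le>n. \<exists>v. val d k v) \<and>
     (\<exists>v. val d n v \<and> (\<forall>\<zeta>\<in>underS L \<xi>. \<forall>k\<le>snd (f \<zeta>). \<not> val (fst (f \<zeta>)) k v))))"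
    for f :: "'l \<Rightarrow> 'a \<times> nat" and \<xi> x
  have "\<exists>f. \<forall>\<xi>. P f \<xi> (f \<xi>)"
  proof (rule dependent_wf_choice[of "L - Id"])
    show "wf (L - Id)" using W by (simp add: well_order_on_def)
  next
    fix f g :: "'l \<Rightarrow> 'a \<times> nat" and \<xi> x
    assume "\<And>z. (z, \<xi>) \<in> L - Id \<Longrightarrow> f z = g z"
    then have "\<And>z. z \<in> underS L \<xi> \<Longrightarrow> f z = g z" by (auto simp: underS_def)
    then show "P f \<xi> x = P g \<xi> x" by (simp add: P_def)
  next
    fix \<xi> and f :: "'l \<Rightarrow> 'a \<times> nat"
    assume IH: "\<And>z. (z, \<xi>) \<in> L - Id \<Longrightarrow> P f z (f z)"
    show "\<exists>x. P f \<xi> x"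
    proof (cases "\<xi> \<in> Field L")
      case False then show ?thesis by (simp add: P_def)
    next
      case \<xi>: True
      \<comment> \<open>These are the values ruled out by stage \<open>\<zeta>\<close>: finitely
        many, since each \<open>k\<close> has at most one decided value.\<close>
      define E where "E \<zeta> = (\<Union>k\<le>snd (f \<zeta>). {v. val (fst (f \<zeta>)) k v})" for \<zeta>
      have "finite (E \<zeta>)" if \<zeta>: "\<zeta> \<in> underS L \<xi>" for \<zeta>
      proof -
        have "P f \<zeta> (f \<zeta>)" "\<zeta> \<in> Field L" using IH \<zeta> by (auto simp: underS_def intro: FieldI1)
        then have f: "fst (f \<zeta>) \<in> conds F" "weaker F p0 (fst (f \<zeta>))"
          using a[of \<zeta>] trans p0 by (auto simp: P_def split: prod.splits)
        have "finite {v. val (fst (f \<zeta>)) k v}" for k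
        proof (cases "\<exists>w. val (fst (f \<zeta>)) k w")
          case True
          then obtain w where "val (fst (f \<zeta>)) k w" by blast
          then have "{v. val (fst (f \<zeta>)) k v} \<subseteq> {w}" using unique f by blast
          then show ?thesis using finite_subset by blast
        qed auto
        then show ?thesis by (simp add: E_def)
      qed
      then obtain v where v: "v \<in> Field L" "v \<notin> (\<Union>\<zeta>\<in>underS L \<xi>. E \<zeta>)"
        using ex_notin_UN_underS[OF L \<xi>] by blast
      have a\<xi>: "a \<xi> \<in> conds F" "weaker F p0 (a \<xi>)" using a \<xi> by auto
      \<comment> \<open>The new value \<open>v\<close> is fixed first; \<open>n\<close> is the
        number to which some extension of \<open>a \<xi>\<close> sends it. Only then are the values
        up to \<open>n\<close> decided.\<close>
      obtain q n where q: "q \<in> conds F" "weaker F (a \<xi>) q" "val q n v"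
        using total[OF v(1) a\<xi>] by blast
      have "weaker F p0 q" using trans p0 a\<xi> q by blast
      then obtain d where d: "d \<in> conds F" "weaker F q d" "\<forall>k\<le>n. \<exists>v. val d k v"
        using decide q by blast
      have "val d n v" using mono[OF q(3) d(2) q(1) d(1)] .
      moreover have "weaker F (a \<xi>) d" using trans[OF q(2) d(2) a\<xi>(1) q(1) d(1)] .
      moreover have "\<not> val (fst (f \<zeta>)) k v" if "\<zeta> \<in> underS L \<xi>" "k \<le> snd (f \<zeta>)" for \<zeta> k
        using v(2) that by (auto simp: E_def)
      ultimately have "P f \<xi> (d, n)"
        unfolding P_def using d by auto
      then show ?thesis by blast
    qed
  qed
  then obtain f where f: "\<And>\<xi>. P f \<xi> (f \<xi>)" by blast
  define d where "d = fst \<circ> f"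
  define n where "n = snd \<circ> f"
  have d: "d \<xi> \<in> conds F" "weaker F (a \<xi>) (d \<xi>)" "\<And>k. k \<le> n \<xi> \<Longrightarrow> \<exists>v. val (d \<xi>) k v"
     and dn: "\<exists>v. val (d \<xi>) (n \<xi>) v \<and> (\<forall>\<zeta>\<in>underS L \<xi>. \<forall>k\<le>n \<zeta>. \<not> val (d \<zeta>) k v)"
    if "\<xi> \<in> Field L" for \<xi>
    using f[of \<xi>] that by (auto simp: P_def d_def n_def split: prod.splits)
  have dp0: "weaker F p0 (d \<xi>)" if "\<xi> \<in> Field L" for \<xi> using that d a trans p0 by blast
  have fin: "finite {\<zeta> \<in> underS L \<xi>. \<exists>p\<in>conds F. weaker F (d \<zeta>) p \<and> weaker F (d \<xi>) p}" (is "finite ?B")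
    if \<xi>: "\<xi> \<in> Field L" for \<xi>
  proof -
    have BF: "\<zeta> \<in> Field L" if "\<zeta> \<in> ?B" for \<zeta> using that by (auto simp: underS_def intro: FieldI1)
    \<comment> \<open>Otherwise \<open>d \<zeta>\<close> decides \<open>g\<close> at
      \<open>n \<xi>\<close>. By compatibility its value there is that of \<open>d \<xi>\<close>,
      which was chosen to avoid it.\<close>
    have less: "n \<zeta> < n \<xi>" if \<zeta>: "\<zeta> \<in> ?B" for \<zeta>
    proof (rule ccontr)
      assume "\<not> n \<zeta> < n \<xi>"
      then obtain w where w: "val (d \<zeta>) (n \<xi>) w" using d(3)[OF BF[OF \<zeta>]] by (meson not_less)
      obtain v where v: "val (d \<xi>) (n \<xi>) v" "\<forall>\<zeta>\<in>underS L \<xi>. \<forall>k\<le>n \<zeta>. \<not> val (d \<zeta>) k v"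
        using dn[OF \<xi>] by blast
      obtain p where p: "p \<in> conds F" "weaker F (d \<zeta>) p" "weaker F (d \<xi>) p" using \<zeta> by blast
      have "val p (n \<xi>) w" "val p (n \<xi>) v" using mono w v(1) p d \<xi> BF[OF \<zeta>] by blast+
      moreover have "weaker F p0 p" using trans dp0[OF \<xi>] p d(1)[OF \<xi>] p0 by blast
      ultimately have "w = v" using unique p by blast
      then show False using v(2) w \<zeta> \<open>\<not> n \<zeta> < n \<xi>\<close> by auto
    qed
    \<comment> \<open>\<open>d \<xi>\<close> decides \<open>g\<close> at this common number, which
      is below \<open>n \<xi>\<close>. Compatibility makes both earlier conditions agree with it,
      whereas the value for \<open>\<zeta>'\<close> was chosen to avoid that for
      \<open>\<zeta>\<close>.\<close>
    have diff: "n \<zeta> \<noteq> n \<zeta>'" if \<zeta>: "\<zeta> \<in> ?B" and \<zeta>': "\<zeta>' \<in> ?B" and lt: "\<zeta> \<in> underS L \<zeta>'" for \<zeta> \<zeta>'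
    proof
      assume eq: "n \<zeta> = n \<zeta>'"
      obtain w where w: "val (d \<xi>) (n \<zeta>) w" using d(3)[OF \<xi>] less[OF \<zeta>] by (meson less_imp_le)
      have *: "v = w" if y: "y \<in> ?B" and v: "val (d y) (n \<zeta>) v" for y v
      proof -
        obtain p where p: "p \<in> conds F" "weaker F (d y) p" "weaker F (d \<xi>) p" using y by blast
        have "val p (n \<zeta>) w" "val p (n \<zeta>) v" using mono w v p d \<xi> BF[OF y] by blast+
        moreover have "weaker F p0 p" using trans dp0[OF \<xi>] p d(1)[OF \<xi>] p0 by blast
        ultimately show "v = w" using unique p by blast
      qed
      obtain v where v: "val (d \<zeta>) (n \<zeta>) v" using dn[OF BF[OF \<zeta>]] by blast
      obtain v' where v': "val (d \<zeta>') (n \<zeta>') v'"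
        "\<forall>\<zeta>\<in>underS L \<zeta>'. \<forall>k\<le>n \<zeta>. \<not> val (d \<zeta>) k v'"
        using dn[OF BF[OF \<zeta>']] by blast
      have "v' = v" using *[OF \<zeta> v] *[OF \<zeta>'] v'(1) eq by simp
      then show False using v v'(2) lt by blast
    qed
    have "inj_on n ?B"
    proof (rule inj_onI, rule ccontr)
      fix x y assume xy: "x \<in> ?B" "y \<in> ?B" "n x = n y" "x \<noteq> y"
      then have "x \<in> underS L y \<or> y \<in> underS L x"
        using TOTALS BF by (auto simp: underS_def)
      then show False using diff[OF xy(1,2)] diff[OF xy(2,1)] xy(3) by auto
    qed
    moreover have "n ` ?B \<subseteq> {..<n \<xi>}" using less by blast
    then have "finite (n ` ?B)" by (rule finite_subset) simp
    ultimately show "finite ?B" using finite_imageD by blast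
  qed
  show ?thesis using d fin by blast
qed

lemma card_between:
  assumes "Card_order r" "|A| =o r" "A \<subseteq> B" "B \<subseteq> Field r"
  shows "|B| =o r"
proof -
  have "|B| \<le>o r"
    using card_of_mono1[OF assms(4)] card_of_Field_ordIso[OF assms(1)] ordLeq_ordIso_trans by blast
  moreover have "r \<le>o |B|"
    using card_of_mono1[OF assms(3)] assms(2) ordIso_ordLeq_trans ordIso_symmetric by blast
  ultimately show ?thesis by (simp add: ordIso_iff_ordLeq)
qed

text \<open>Conditions of \<open>subset_forcing r\<close> are compatible exactly when their
  intersection has size \<open>r\<close>, so \<open>separated_refinement\<close> becomes a statement
  about almost disjointness.\<close>

lemma almost_disjoint_refinement:
  fixes L :: "'l rel" and r :: "'a rel"
  assumes r: "Card_order r" and L: "Card_order L" "infinite (Field L)"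
    and col: "collapses_to_omega (subset_forcing r) L"
    and a: "\<And>\<xi>. \<xi> \<in> Field L \<Longrightarrow> a \<xi> \<subseteq> Field r \<and> |a \<xi>| =o r"
  shows "\<exists>d. \<forall>\<xi>\<in>Field L. d \<xi> \<subseteq> a \<xi> \<and> |d \<xi>| =o r \<and>
    finite {\<zeta> \<in> underS L \<xi>. |d \<zeta> \<inter> d \<xi>| =o r}"
proof -
  let ?F = "subset_forcing r"
  have F: "forcing_order ?F" using forcing_order_subset_forcing[OF r] .
  have "weakest ?F \<in> conds ?F" "weaker ?F (weakest ?F) (weakest ?F)"
    using F unfolding forcing_order_def by auto
  then obtain p0 \<tau> where p0: "p0 \<in> conds ?F"
    and bij: "forces_bijection ?F (Field L) (UNIV :: nat set) \<tau> p0"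
    using col unfolding collapses_to_omega_def forces_equinumerous_def forces_ex_def by meson
  \<comment> \<open>The bijection is only available below \<open>p0\<close>, so the family is first moved into \<open>p0\<close>.\<close>
  have p0': "p0 \<subseteq> Field r" "|p0| =o r" using p0 by (auto simp: subset_forcing_def)
  have "|Field r| =o |p0|"
    using card_of_Field_ordIso[OF r] p0'(2) ordIso_symmetric ordIso_transitive by blast
  then obtain h where h: "bij_betw h (Field r) p0" using card_of_ordIso by blast
  have card_h: "|h ` A| =o |A|" if "A \<subseteq> Field r" for A
    using card_of_ordIso bij_betw_subset[OF h that] ordIso_symmetric by blast
  have "\<exists>d. \<forall>\<xi>\<in>Field L. d \<xi> \<in> conds ?F \<and> weaker ?F (h ` a \<xi>) (d \<xi>) \<and>
    finite {\<zeta> \<in> underS L \<xi>. \<exists>p\<in>conds ?F. weaker ?F (d \<zeta>) p \<and> weaker ?F (d \<xi>) p}"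
  proof (rule separated_refinement[OF F L bij p0])
    fix \<xi> assume "\<xi> \<in> Field L"
    then have "|h ` a \<xi>| =o r" "h ` a \<xi> \<subseteq> p0"
      using ordIso_transitive[OF card_h[of "a \<xi>"]] a[of \<xi>] h by (auto simp: bij_betw_def)
    then show "h ` a \<xi> \<in> conds ?F \<and> weaker ?F p0 (h ` a \<xi>)"
      using p0' by (auto simp: subset_forcing_def)
  qed
  then obtain d where d: "\<forall>\<xi>\<in>Field L. d \<xi> \<subseteq> Field r \<and> |d \<xi>| =o r \<and> d \<xi> \<subseteq> h ` a \<xi> \<and>
    finite {\<zeta> \<in> underS L \<xi>. \<exists>p. p \<subseteq> Field r \<and> |p| =o r \<and> p \<subseteq> d \<zeta> \<and> p \<subseteq> d \<xi>}"
    by (auto simp: subset_forcing_def)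
  \<comment> \<open>Pulling back along the injection \<open>h\<close> returns to subsets of
    \<open>a \<xi>\<close>. A large \<open>e \<zeta> \<inter> e \<xi>\<close> has as its image under
    \<open>h\<close> a common extension of \<open>d \<zeta>\<close> and
    \<open>d \<xi>\<close>.\<close>
  define e where "e \<xi> = {x \<in> a \<xi>. h x \<in> d \<xi>}" for \<xi>
  have he: "h ` e \<xi> = d \<xi>" if "\<xi> \<in> Field L" for \<xi> using d that unfolding e_def by blast
  have "|e \<xi>| =o r" if "\<xi> \<in> Field L" for \<xi>
  proof -
    have "e \<xi> \<subseteq> Field r" using a that by (auto simp: e_def)
    then have "|d \<xi>| =o |e \<xi>|" using card_h he that by metis
    then show ?thesis using d that ordIso_transitive ordIso_symmetric by blast
  qed
  moreover have "finite {\<zeta> \<in> underS L \<xi>. |e \<zeta> \<inter> e \<xi>| =o r}" if \<xi>: "\<xi> \<in> Field L" for \<xi>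
  proof (rule finite_subset)
    show "finite {\<zeta> \<in> underS L \<xi>. \<exists>p. p \<subseteq> Field r \<and> |p| =o r \<and> p \<subseteq> d \<zeta> \<and> p \<subseteq> d \<xi>}"
      using d \<xi> by blast
    have "\<exists>p. p \<subseteq> Field r \<and> |p| =o r \<and> p \<subseteq> d \<zeta> \<and> p \<subseteq> d \<xi>"
      if "\<zeta> \<in> underS L \<xi>" "|e \<zeta> \<inter> e \<xi>| =o r" for \<zeta>
    proof -
      have "\<zeta> \<in> Field L" using that by (auto simp: underS_def intro: FieldI1)
      then have "e \<zeta> \<inter> e \<xi> \<subseteq> Field r" "h ` (e \<zeta> \<inter> e \<xi>) \<subseteq> d \<zeta>" "h ` (e \<zeta> \<inter> e \<xi>) \<subseteq> d \<xi>"
        using a by (auto simp: e_def)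
      moreover have "d \<xi> \<subseteq> Field r" using d \<xi> by blast
      ultimately show ?thesis
        using ordIso_transitive[OF card_h[of "e \<zeta> \<inter> e \<xi>"] that(2)]
        by (intro exI[of _ "h ` (e \<zeta> \<inter> e \<xi>)"]) simp
    qed
    then show "{\<zeta> \<in> underS L \<xi>. |e \<zeta> \<inter> e \<xi>| =o r} \<subseteq>
      {\<zeta> \<in> underS L \<xi>. \<exists>p. p \<subseteq> Field r \<and> |p| =o r \<and> p \<subseteq> d \<zeta> \<and> p \<subseteq> d \<xi>}"
      by auto
  qed
  ultimately show ?thesis by (intro exI[of _ e]) (auto simp: e_def)
qed

section \<open>Subtrees of Miller trees\<close>

definition succs :: "'a rel \<Rightarrow> ('a \<rightharpoonup> 'a) set \<Rightarrow> ('a \<rightharpoonup> 'a) \<Rightarrow> 'a set" where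
  "succs r T t = {i \<in> Field r. seq_snoc r t i \<in> T}"

lemma splitting_node_iff: "splitting_node r T t \<longleftrightarrow> t \<in> T \<and> |succs r T t| =o r"
  by (simp add: splitting_node_def succs_def)

lemma succs_mono: "S \<subseteq> T \<Longrightarrow> succs r S t \<subseteq> succs r T t"
  by (auto simp: succs_def)

lemma succs_subset_Field: "succs r T t \<subseteq> Field r"
  by (auto simp: succs_def)

lemma map_le_common:
  assumes "s \<subseteq>\<^sub>m u" "t \<subseteq>\<^sub>m u" "dom s \<subseteq> dom t"
  shows "s \<subseteq>\<^sub>m t"
  unfolding map_le_def
proof
  fix x assume "x \<in> dom s"
  moreover from this have "x \<in> dom t" using assms by blast
  ultimately show "s x = t x" using assms(1,2) by (simp add: map_le_def)
qed

lemma map_le_antisym_dom: "s \<subseteq>\<^sub>m t \<Longrightarrow> dom t \<subseteq> dom s \<Longrightarrow> s = t"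
  by (rule map_le_antisym, assumption) (rule map_le_common[OF map_le_refl])

lemma map_le_iff_graph: "s \<subseteq>\<^sub>m t \<longleftrightarrow> Map.graph s \<subseteq> Map.graph t"
  by (auto simp: map_le_def Map.graph_def dom_def)

lemma map_le_Some: "s \<subseteq>\<^sub>m t \<Longrightarrow> s x = Some y \<Longrightarrow> t x = Some y"
  by (metis domI map_le_def)

lemma seq_tree_subset: "miller_tree r T \<Longrightarrow> T \<subseteq> seqs r"
  by (simp add: miller_tree_def seq_tree_def)

lemma miller_tree_limit:
  assumes "miller_tree r T" "b \<in> Field r" "underS r b \<noteq> {}" "u \<in> seqs r"
    and "\<forall>c\<in>underS r b. splitting_node r T (s c)"
    and "\<forall>c\<in>underS r b. \<forall>e\<in>underS r b. (c, e) \<in> r \<longrightarrow> s c \<subseteq>\<^sub>m s e"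
    and "Map.graph u = (\<Union>c\<in>underS r b. Map.graph (s c))"
  shows "splitting_node r T u"
  using assms(1)[unfolded miller_tree_def, THEN conjunct2, THEN conjunct2, THEN bspec, OF assms(2),
      THEN spec, THEN bspec, OF assms(4), THEN mp, OF assms(3), THEN mp, OF assms(5),
      THEN mp, OF assms(6), THEN mp, OF assms(7)] .

lemma miller_treeI:
  assumes "seq_tree r T" "\<And>s. s \<in> T \<Longrightarrow> \<exists>t\<in>T. s \<subseteq>\<^sub>m t \<and> splitting_node r T t"
    and "\<And>b s u. \<lbrakk>b \<in> Field r; underS r b \<noteq> {}; u \<in> seqs r; \<forall>c\<in>underS r b. splitting_node r T (s c);
      \<forall>c\<in>underS r b. \<forall>e\<in>underS r b. (c, e) \<in> r \<longrightarrow> s c \<subseteq>\<^sub>m s e;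
      Map.graph u = (\<Union>c\<in>underS r b. Map.graph (s c))\<rbrakk> \<Longrightarrow> splitting_node r T u"
  shows "miller_tree r T"
  unfolding miller_tree_def by (intro conjI ballI allI impI assms(1)) (erule assms(2), rule assms(3))

lemma seq_snoc_length: "seq_snoc r t i (seq_length r t) = Some i"
  by (simp add: seq_snoc_def)

text \<open>Prunes \<open>T\<close> at its splitting nodes \<open>s\<close> to the successors in
  \<open>d s\<close>; at the other nodes nothing is cut.\<close>

definition thin :: "'a rel \<Rightarrow> ('a \<rightharpoonup> 'a) set \<Rightarrow> (('a \<rightharpoonup> 'a) \<Rightarrow> 'a set) \<Rightarrow> ('a \<rightharpoonup> 'a) set" where
  "thin r T d = {t \<in> T. \<forall>s i. splitting_node r T s \<longrightarrow> s \<subseteq>\<^sub>m t \<longrightarrow> t (seq_length r s) = Some i \<longrightarrow> i \<in> d s}"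

text \<open>The usual restriction of a tree to a node.\<close>

definition cone :: "('a \<rightharpoonup> 'a) set \<Rightarrow> ('a \<rightharpoonup> 'a) \<Rightarrow> ('a \<rightharpoonup> 'a) set" where
  "cone T t = {s \<in> T. s \<subseteq>\<^sub>m t \<or> t \<subseteq>\<^sub>m s}"

section \<open>Thinned trees and cones are Miller trees\<close>

context
  fixes r :: "'a rel"
  assumes r: "Card_order r" and inf: "infinite (Field r)"
begin

lemma well: "Well_order r"
  using r card_order_on_well_order_on by blast

lemma underS_trans: "x \<in> underS r y \<Longrightarrow> y \<in> underS r z \<Longrightarrow> x \<in> underS r z"
  using wo_rel.TRANS[OF wo_rel.intro[OF well]] wo_rel.ANTISYM[OF wo_rel.intro[OF well]]
  unfolding underS_def by (auto dest: transD antisymD)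

lemma underS_total: "x \<in> Field r \<Longrightarrow> y \<in> Field r \<Longrightarrow> x \<in> underS r y \<or> x = y \<or> y \<in> underS r x"
  using wo_rel.TOTALS[OF wo_rel.intro[OF well]] unfolding underS_def by auto

lemma seq_length_Field_dom:
  assumes "t \<in> seqs r"
  shows "seq_length r t \<in> Field r \<and> dom t = underS r (seq_length r t)"
  using assms seq_length_eq[OF well] unfolding seqs_def by fastforce

lemma seq_length_notin_dom: "t \<in> seqs r \<Longrightarrow> seq_length r t \<notin> dom t"
  using seq_length_Field_dom[of t] by (auto simp: underS_def)

lemma seq_length_cases:
  assumes "s \<in> seqs r" "t \<in> seqs r"
  obtains "seq_length r s \<in> dom t" | "dom s = dom t" | "seq_length r t \<in> dom s"
  using underS_total seq_length_Field_dom assms by metis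

lemma dom_subset_of_length: "s \<in> seqs r \<Longrightarrow> t \<in> seqs r \<Longrightarrow> seq_length r s \<in> dom t \<Longrightarrow> dom s \<subseteq> dom t"
  using underS_trans seq_length_Field_dom by blast

lemma dom_linear: "s \<in> seqs r \<Longrightarrow> t \<in> seqs r \<Longrightarrow> dom s \<subseteq> dom t \<or> dom t \<subseteq> dom s"
  by (metis dom_subset_of_length order_refl seq_length_cases)

lemma map_le_linear:
  "s \<in> seqs r \<Longrightarrow> t \<in> seqs r \<Longrightarrow> s \<subseteq>\<^sub>m u \<Longrightarrow> t \<subseteq>\<^sub>m u \<Longrightarrow> s \<subseteq>\<^sub>m t \<or> t \<subseteq>\<^sub>m s"
  using dom_linear[of s t] map_le_common[of s u t] map_le_common[of t u s] by blast

lemma map_le_seq_snoc: "t \<in> seqs r \<Longrightarrow> t \<subseteq>\<^sub>m seq_snoc r t i"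
  using seq_length_notin_dom[of t] by (auto simp: map_le_def seq_snoc_def)

lemma dom_seq_snoc: "dom (seq_snoc r t i) = insert (seq_length r t) (dom t)"
  by (simp add: seq_snoc_def)

lemma infinite_of_ordIso: "|A| =o r \<Longrightarrow> infinite A"
  using inf card_of_Field_ordIso[OF r] card_of_ordIso_finite[of A "Field r"]
    ordIso_transitive[of "|A|" r "|Field r|"] ordIso_symmetric by blast

lemma splitting_node_mono: "splitting_node r S t \<Longrightarrow> S \<subseteq> T \<Longrightarrow> splitting_node r T t"
  unfolding splitting_node_iff
  using card_between[OF r _ succs_mono[of S T r t] succs_subset_Field] by blast

lemma thin_subset: "thin r T d \<subseteq> T"
  by (auto simp: thin_def)

text \<open>A splitting node of \<open>T\<close> that tests a value of \<open>seq_snoc r s i\<close>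
  is either \<open>s\<close> itself, where \<open>i \<in> d s\<close> is what is asked, or a proper
  initial segment of \<open>s\<close>, where \<open>s\<close> already meets the requirement.\<close>

lemma succs_thin:
  assumes T: "miller_tree r T" and d: "d s \<subseteq> succs r T s"
    and s: "s \<in> thin r T d" "splitting_node r T s"
  shows "succs r (thin r T d) s = d s"
proof
  have sT: "s \<in> seqs r" using s(2) seq_tree_subset[OF T] by (auto simp: splitting_node_def)
  show "succs r (thin r T d) s \<subseteq> d s"
    using s(2) map_le_seq_snoc[OF sT] seq_snoc_length[of r s] by (auto simp: succs_def thin_def)
  show "d s \<subseteq> succs r (thin r T d) s"
  proof
    fix i assume i: "i \<in> d s"
    have "j \<in> d v" if v: "splitting_node r T v" "v \<subseteq>\<^sub>m seq_snoc r s i"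
      and j: "seq_snoc r s i (seq_length r v) = Some j" for v j
    proof -
      have vT: "v \<in> seqs r" using v seq_tree_subset[OF T] by (auto simp: splitting_node_def)
      have "seq_length r v \<in> insert (seq_length r s) (dom s)" using j dom_seq_snoc[of s i] by blast
      then consider "seq_length r v = seq_length r s" | "seq_length r v \<in> dom s" by blast
      then show ?thesis
      proof cases
        case 1
        then have "dom v = dom s" using seq_length_Field_dom sT vT by metis
        then have "v \<subseteq>\<^sub>m s" using map_le_common[OF v(2) map_le_seq_snoc[OF sT]] by simp
        then have "v = s" using \<open>dom v = dom s\<close> map_le_antisym_dom by blast
        then show ?thesis using j i by (simp add: seq_snoc_length)
      next
        case 2
        have "v \<subseteq>\<^sub>m s"
          using map_le_common[OF v(2) map_le_seq_snoc[OF sT]] dom_subset_of_length[OF vT sT 2] by blast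
        moreover have "s (seq_length r v) = Some j"
          using j 2 seq_length_notin_dom[OF sT] by (auto simp: seq_snoc_def split: if_splits)
        ultimately show ?thesis using s(1) v(1) by (auto simp: thin_def)
      qed
    qed
    then show "i \<in> succs r (thin r T d) s"
      using i d by (auto simp: succs_def thin_def)
  qed
qed

text \<open>Nodes of the thinned tree that split in \<open>T\<close> still split, by
  \<open>succs_thin\<close>. So it suffices that enough splitting nodes of \<open>T\<close>, and the
  limits of such nodes, survive the thinning.\<close>

lemma miller_tree_thin:
  assumes T: "miller_tree r T"
    and d: "\<And>s. splitting_node r T s \<Longrightarrow> d s \<subseteq> succs r T s \<and> |d s| =o r"
  shows "miller_tree r (thin r T d)"
proof -
  have Ts: "T \<subseteq> seqs r" "T \<noteq> {}" and down: "\<And>t s. t \<in> T \<Longrightarrow> s \<in> seqs r \<Longrightarrow> s \<subseteq>\<^sub>m t \<Longrightarrow> s \<in> T"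
    using T by (auto simp: miller_tree_def seq_tree_def)
  have split: "splitting_node r (thin r T d) t" if "t \<in> thin r T d" "splitting_node r T t" for t
    using that succs_thin[OF T _ that] d[OF that(2)] by (simp add: splitting_node_iff)
  have down': "s \<in> thin r T d" if "t \<in> thin r T d" "s \<in> seqs r" "s \<subseteq>\<^sub>m t" for s t
    using that down[of t s] map_le_trans[of _ s t] map_le_Some[of s t] unfolding thin_def by blast
  have len_seqs: "splitting_node r T t \<Longrightarrow> t \<in> seqs r" for t
    using Ts by (auto simp: splitting_node_def)
  have ext: "\<exists>t\<in>thin r T d. s \<subseteq>\<^sub>m t \<and> splitting_node r (thin r T d) t" if s: "s \<in> thin r T d" for s
  proof -
    let ?Q = "{t. splitting_node r T t \<and> s \<subseteq>\<^sub>m t}"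
    have sT: "s \<in> T" "s \<in> seqs r" using s Ts by (auto simp: thin_def)
    have "wf (inv_image (r - Id) (seq_length r))"
      using well by (simp add: well_order_on_def)
    moreover obtain t0 where "t0 \<in> ?Q" using T sT by (auto simp: miller_tree_def)
    \<comment> \<open>For a shortest splitting node \<open>t\<close> of \<open>T\<close> above
      \<open>s\<close>, no node from \<open>s\<close> up to but excluding \<open>t\<close> splits in
      \<open>T\<close>, so reaching \<open>t\<close> asks for nothing that \<open>s\<close> does not
      already satisfy.\<close>
    ultimately obtain t where t: "t \<in> ?Q" and
      min: "\<And>v. (v, t) \<in> inv_image (r - Id) (seq_length r) \<Longrightarrow> v \<notin> ?Q"
      by (rule wfE_min) blast
    have tT: "t \<in> T" "t \<in> seqs r" using t Ts by (auto simp: splitting_node_def)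
    have "i \<in> d v" if v: "splitting_node r T v" "v \<subseteq>\<^sub>m t" and i: "t (seq_length r v) = Some i" for v i
    proof -
      have vs: "v \<in> seqs r" using v Ts by (auto simp: splitting_node_def)
      have "seq_length r v \<in> underS r (seq_length r t)" using i seq_length_Field_dom[OF tT(2)] by blast
      then have "(v, t) \<in> inv_image (r - Id) (seq_length r)" by (auto simp: underS_def)
      then have ns: "\<not> s \<subseteq>\<^sub>m v" using min v by blast
      have vsle: "v \<subseteq>\<^sub>m s" using map_le_linear[OF vs sT(2) v(2)] t ns by blast
      have "seq_length r v \<in> dom s"
      proof (rule seq_length_cases[OF vs sT(2)])
        assume "dom v = dom s" then have "v = s" using map_le_antisym_dom[OF vsle] by simp
        then show ?thesis using ns by simp
      next
        assume "seq_length r s \<in> dom v"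
        then have "v = s"
          using map_le_antisym_dom[OF vsle] dom_subset_of_length[OF sT(2) vs] by simp
        then show ?thesis using ns by simp
      qed
      then have "s (seq_length r v) = Some i" using t i by (auto simp: map_le_def)
      then show ?thesis using s v(1) vsle by (auto simp: thin_def)
    qed
    then have "t \<in> thin r T d" using tT by (auto simp: thin_def)
    then show ?thesis using split t by blast
  qed
  have lim: "splitting_node r (thin r T d) u"
    if b: "b \<in> Field r" "underS r b \<noteq> {}" and u: "u \<in> seqs r"
      and s: "\<forall>c\<in>underS r b. splitting_node r (thin r T d) (s c)"
      and incr: "\<forall>c\<in>underS r b. \<forall>e\<in>underS r b. (c, e) \<in> r \<longrightarrow> s c \<subseteq>\<^sub>m s e"
      and g: "Map.graph u = (\<Union>c\<in>underS r b. Map.graph (s c))" for b s u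
  proof -
    have sT: "\<forall>c\<in>underS r b. splitting_node r T (s c)" using s splitting_node_mono thin_subset by blast
    then have uT: "splitting_node r T u"
      using miller_tree_limit[OF T b u _ incr g] by blast
    have "i \<in> d v" if v: "splitting_node r T v" "v \<subseteq>\<^sub>m u" and i: "u (seq_length r v) = Some i" for v i
    proof -
      \<comment> \<open>The tested value of \<open>u\<close> already occurs in some
        \<open>s c\<close>, which belongs to the thinned tree.\<close>
      have "(seq_length r v, i) \<in> (\<Union>c\<in>underS r b. Map.graph (s c))"
        using in_graphI[of u, OF i] g by simp
      then obtain c where c: "c \<in> underS r b" "s c (seq_length r v) = Some i"
        using in_graphD by fast
      have "s c \<subseteq>\<^sub>m u" using g c(1) by (auto simp: map_le_iff_graph)
      moreover have "dom v \<subseteq> dom (s c)"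
        using dom_subset_of_length[OF len_seqs len_seqs] v(1) sT c by blast
      ultimately have "v \<subseteq>\<^sub>m s c" using map_le_common[OF v(2)] by blast
      moreover have "s c \<in> thin r T d" using s c(1) by (simp add: splitting_node_def)
      ultimately show ?thesis using v(1) c(2) by (auto simp: thin_def)
    qed
    then have "u \<in> thin r T d" using uT by (auto simp: thin_def splitting_node_def)
    then show ?thesis using split uT by blast
  qed
  have "thin r T d \<noteq> {}"
  proof -
    obtain t where t: "t \<in> T" using Ts by blast
    have "Map.empty \<in> seqs r"
    proof -
      have "Field r \<noteq> {}" using inf by auto
      then have "underS r (wo_rel.minim r (Field r)) = {}" "wo_rel.minim r (Field r) \<in> Field r"
        using wo_rel.minim_least[OF wo_rel.intro[OF well], of "Field r"]
          wo_rel.minim_in[OF wo_rel.intro[OF well], of "Field r"]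
          wo_rel.ANTISYM[OF wo_rel.intro[OF well]]
        by (auto simp: underS_def antisym_def dest: FieldI1)
      then show ?thesis by (auto simp: seqs_def intro!: bexI[of _ "wo_rel.minim r (Field r)"])
    qed
    then have "Map.empty \<in> thin r T d" using down[OF t] by (auto simp: thin_def)
    then show ?thesis by blast
  qed
  then have "seq_tree r (thin r T d)"
    using Ts thin_subset down' unfolding seq_tree_def by blast
  then show ?thesis using ext lim by (rule miller_treeI)
qed

text \<open>A node properly below \<open>t\<close> has at most one successor in the cone, the one
  leading towards \<open>t\<close>, so it cannot split.\<close>

lemma splitting_node_cone_above:
  assumes T: "miller_tree r T" and t: "t \<in> T" and s: "splitting_node r (cone T t) s"
  shows "t \<subseteq>\<^sub>m s"
proof (rule ccontr)
  assume n: "\<not> t \<subseteq>\<^sub>m s"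
  have sT: "s \<in> T" "s \<subseteq>\<^sub>m t" using s n by (auto simp: splitting_node_def cone_def)
  have seqs: "s \<in> seqs r" "t \<in> seqs r" using t sT seq_tree_subset[OF T] by auto
  have dom: "seq_length r s \<in> dom t"
  proof (rule seq_length_cases[OF seqs])
    assume "dom s = dom t" then show ?thesis using map_le_antisym_dom[OF sT(2)] n by simp
  next
    assume "seq_length r t \<in> dom s"
    then show ?thesis using map_le_antisym_dom[OF sT(2)] dom_subset_of_length[OF seqs(2,1)] n by simp
  qed
  have "i = the (t (seq_length r s))" if "i \<in> succs r (cone T t) s" for i
  proof -
    have "seq_snoc r s i \<subseteq>\<^sub>m t \<or> t \<subseteq>\<^sub>m seq_snoc r s i" using that by (auto simp: succs_def cone_def)
    then show ?thesis
    proof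
      assume "seq_snoc r s i \<subseteq>\<^sub>m t"
      then have "t (seq_length r s) = Some i" using map_le_Some seq_snoc_length by metis
      then show ?thesis by simp
    next
      assume "t \<subseteq>\<^sub>m seq_snoc r s i"
      then have "t (seq_length r s) = seq_snoc r s i (seq_length r s)" using dom by (simp add: map_le_def)
      then show ?thesis by (simp add: seq_snoc_length)
    qed
  qed
  then have "succs r (cone T t) s \<subseteq> {the (t (seq_length r s))}" by blast
  then have "finite (succs r (cone T t) s)" by (rule finite_subset) simp
  then show False using s infinite_of_ordIso by (auto simp: splitting_node_iff)
qed

lemma splitting_node_cone:
  assumes T: "miller_tree r T" and s: "splitting_node r T s" and ts: "t \<subseteq>\<^sub>m s"
  shows "splitting_node r (cone T t) s"
proof -
  have "s \<in> seqs r" using s seq_tree_subset[OF T] by (auto simp: splitting_node_def)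
  then have "t \<subseteq>\<^sub>m seq_snoc r s i" for i using map_le_trans[OF ts map_le_seq_snoc] by blast
  then have "succs r (cone T t) s = succs r T s" by (auto simp: succs_def cone_def)
  then show ?thesis using s ts by (simp add: splitting_node_iff cone_def)
qed

text \<open>Cones serve to make the splitting nodes of later subtrees extend a prescribed node.
  Above \<open>t\<close> the cone has the same splitting nodes as \<open>T\<close>.\<close>

lemma miller_tree_cone:
  assumes T: "miller_tree r T" and t: "t \<in> T"
  shows "miller_tree r (cone T t)"
proof -
  have Ts: "T \<subseteq> seqs r" and down: "\<And>t s. t \<in> T \<Longrightarrow> s \<in> seqs r \<Longrightarrow> s \<subseteq>\<^sub>m t \<Longrightarrow> s \<in> T"
    and ext: "\<And>s. s \<in> T \<Longrightarrow> \<exists>t\<in>T. s \<subseteq>\<^sub>m t \<and> splitting_node r T t"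
    using T by (auto simp: miller_tree_def seq_tree_def)
  have tcone: "t \<in> cone T t" using t by (simp add: cone_def)
  have "s \<in> cone T t" if v: "v \<in> cone T t" and s: "s \<in> seqs r" "s \<subseteq>\<^sub>m v" for s v
  proof -
    have "s \<in> T" using down v s by (auto simp: cone_def)
    moreover have "s \<subseteq>\<^sub>m t \<or> t \<subseteq>\<^sub>m s"
      using v s t Ts map_le_linear[of s t v] map_le_trans[of s v t] by (auto simp: cone_def)
    ultimately show ?thesis by (simp add: cone_def)
  qed
  moreover have "cone T t \<subseteq> seqs r" using Ts by (auto simp: cone_def)
  ultimately have "seq_tree r (cone T t)" using tcone unfolding seq_tree_def by blast
  moreover have "\<exists>v\<in>cone T t. s \<subseteq>\<^sub>m v \<and> splitting_node r (cone T t) v" if s: "s \<in> cone T t" for s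
  proof (cases "t \<subseteq>\<^sub>m s")
    case True
    obtain v where v: "s \<subseteq>\<^sub>m v" "splitting_node r T v" using ext s by (auto simp: cone_def)
    then have "splitting_node r (cone T t) v"
      using splitting_node_cone[OF T] map_le_trans[OF True] by blast
    then show ?thesis using v by (auto simp: splitting_node_def)
  next
    case False
    then have st: "s \<subseteq>\<^sub>m t" using s by (simp add: cone_def)
    obtain v where v: "t \<subseteq>\<^sub>m v" "splitting_node r T v" using ext t by blast
    then have "splitting_node r (cone T t) v"
      using splitting_node_cone[OF T] by blast
    then show ?thesis using map_le_trans[OF st v(1)] by (auto simp: splitting_node_def)
  qed
  moreover have "splitting_node r (cone T t) u"
    if b: "b \<in> Field r" "underS r b \<noteq> {}" and u: "u \<in> seqs r"
      and s: "\<forall>c\<in>underS r b. splitting_node r (cone T t) (s c)"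
      and incr: "\<forall>c\<in>underS r b. \<forall>e\<in>underS r b. (c, e) \<in> r \<longrightarrow> s c \<subseteq>\<^sub>m s e"
      and g: "Map.graph u = (\<Union>c\<in>underS r b. Map.graph (s c))" for b s u
  proof -
    have cT: "cone T t \<subseteq> T" by (auto simp: cone_def)
    have "\<forall>c\<in>underS r b. splitting_node r T (s c)" using s splitting_node_mono[OF _ cT] by blast
    then have uT: "splitting_node r T u"
      using miller_tree_limit[OF T b u _ incr g] by blast
    \<comment> \<open>The sequence is nonempty, so its limit extends one of its members and hence
      \<open>t\<close>.\<close>
    obtain c where c: "c \<in> underS r b" using b by blast
    have "s c \<subseteq>\<^sub>m u" using g c by (auto simp: map_le_iff_graph)
    then have "t \<subseteq>\<^sub>m u" using splitting_node_cone_above[OF T t] s c map_le_trans by blast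
    then show ?thesis using splitting_node_cone[OF T uT] by blast
  qed
  ultimately show ?thesis by (rule miller_treeI)
qed

end

section \<open>Limits of splitting nodes\<close>

lemma infinite_Field:
  assumes "Card_order r" "natLeq <o r"
  shows "infinite (Field r)"
proof -
  have "natLeq \<le>o |Field r|"
    using ordLess_imp_ordLeq[OF assms(2)] card_of_Field_ordIso[OF assms(1)]
      ordLeq_ordIso_trans ordIso_symmetric by blast
  then show ?thesis using infinite_iff_natLeq_ordLeq by blast
qed

lemma chain_map_le:
  assumes "\<And>n. t n \<subseteq>\<^sub>m t (Suc n)" "m \<le> n"
  shows "t m \<subseteq>\<^sub>m t n"
  using assms(2)
proof (induction n rule: dec_induct)
  case (step n)
  then show ?case using assms(1)[of n] map_le_trans by blast
qed simp

text \<open>The union of the chain is a function whose domain is an initial segment of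
  \<open>r\<close>. Since the cofinality is uncountable, the countably many lengths are not cofinal,
  so this segment is proper.\<close>

lemma ex_chain_limit:
  assumes r: "Card_order r" "infinite (Field r)" and cof: "natLeq <o cofinality r"
    and t: "\<And>n. t n \<in> seqs r" and chain: "\<And>n. t n \<subseteq>\<^sub>m t (Suc n)"
  shows "\<exists>u\<in>seqs r. Map.graph u = (\<Union>n::nat. Map.graph (t n))"
proof -
  have W: "wo_rel r" using r(1) card_order_on_well_order_on by (simp add: wo_rel_def)
  have coh: "t m x = t n x" if "x \<in> dom (t m)" "x \<in> dom (t n)" for m n x
  proof (cases "m \<le> n")
    case True then show ?thesis using chain_map_le[of t, OF chain True] that by (simp add: map_le_def)
  next
    case False
    then have "n \<le> m" by simp
    then show ?thesis using chain_map_le[of t, OF chain \<open>n \<le> m\<close>] that by (simp add: map_le_def)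
  qed
  \<comment> \<open>The choice of \<open>n\<close> does not matter, by the coherence
    \<open>coh\<close>.\<close>
  define u where "u x = (if \<exists>n. x \<in> dom (t n) then t (SOME n. x \<in> dom (t n)) x else None)" for x
  have u: "u x = t n x" if "x \<in> dom (t n)" for x n
  proof -
    have ex: "\<exists>n. x \<in> dom (t n)" using that by blast
    show ?thesis unfolding u_def if_P[OF ex] by (rule coh[OF someI_ex[OF ex] that])
  qed
  have u': "\<exists>n. t n x = Some y" if "u x = Some y" for x y
    using that by (auto simp: u_def split: if_splits)
  have g: "Map.graph u = (\<Union>n. Map.graph (t n))"
  proof (intro equalityI subsetI)
    fix z assume "z \<in> Map.graph u"
    then show "z \<in> (\<Union>n. Map.graph (t n))" using u' by (auto simp: Map.graph_def)
  next
    fix z assume "z \<in> (\<Union>n. Map.graph (t n))"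
    then obtain n x y where "z = (x, y)" "t n x = Some y" by (auto simp: Map.graph_def)
    then show "z \<in> Map.graph u" using u[of x n] by (auto simp: Map.graph_def)
  qed
  have dom: "dom u = (\<Union>n. dom (t n))"
  proof (intro equalityI subsetI)
    fix x assume "x \<in> dom u"
    then show "x \<in> (\<Union>n. dom (t n))" using u' by blast
  next
    fix x assume "x \<in> (\<Union>n. dom (t n))"
    then obtain n where n: "x \<in> dom (t n)" by blast
    then show "x \<in> dom u" using u[OF n] by (simp add: dom_def)
  qed
  have ran: "ran u \<subseteq> Field r"
    using u' t unfolding seqs_def ran_def by fast
  have ts: "\<exists>a\<in>Field r. dom (t n) = underS r a" for n using t[of n] by (auto simp: seqs_def)
  then have "\<forall>n. \<exists>a. a \<in> Field r \<and> dom (t n) = underS r a" by blast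
  then obtain l where l: "\<And>n. l n \<in> Field r" "\<And>n. dom (t n) = underS r (l n)" by metis
  have "wo_rel.ofilter r (dom u)"
    unfolding dom l(2) by (intro wo_rel.ofilter_UNION[OF W] wo_rel.underS_ofilter[OF W])
  moreover have "dom u \<noteq> Field r"
  proof
    assume F: "dom u = Field r"
    have "cofinal (range l) r"
      unfolding cofinal_def
    proof
      fix a assume "a \<in> Field r"
      then obtain n where "a \<in> underS r (l n)" using F dom l(2) by blast
      then show "\<exists>b\<in>range l. a \<noteq> b \<and> (a, b) \<in> r" by (auto simp: underS_def)
    qed
    moreover have "range l \<subseteq> Field r" using l by blast
    ultimately have "cofinality r \<le>o |range l|" using least_cofinality[OF r] by blast
    also have "|range l| \<le>o |UNIV :: nat set|" by (rule card_of_image)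
    also have "|UNIV :: nat set| =o natLeq" by (rule card_of_nat)
    finally show False using cof not_ordLess_ordLeq by blast
  qed
  ultimately obtain a where "a \<in> Field r" "dom u = underS r a"
    unfolding wo_rel.ofilter_underS_Field[OF W] by blast
  then have "u \<in> seqs r" using ran by (auto simp: seqs_def)
  then show ?thesis using g by blast
qed

text \<open>The closure condition of \<open>miller_tree\<close> speaks of sequences indexed by an
  ordinal \<open>b\<close> in \<open>Field r\<close>. As \<open>r\<close> is uncountable, some
  \<open>b\<close> is a copy of \<omega>, and the chain is reindexed along the isomorphism.\<close>

lemma splitting_node_chain_limit:
  assumes r: "Well_order r" and unc: "natLeq <o r" and T: "miller_tree r T"
    and t: "\<And>n. splitting_node r T (t n)" and chain: "\<And>n. t n \<subseteq>\<^sub>m t (Suc n)"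
    and u: "u \<in> seqs r" and g: "Map.graph u = (\<Union>n::nat. Map.graph (t n))"
  shows "splitting_node r T u"
proof -
  obtain b where b: "b \<in> Field r" "natLeq =o Restr r (underS r b)"
    using unc ordLess_iff_ordIso_Restr[OF r natLeq_Well_order] by blast
  then obtain f where f: "iso natLeq (Restr r (underS r b)) f" by (auto simp: ordIso_def)
  have "Refl r" using r by (simp add: order_on_defs)
  moreover have "underS r b \<subseteq> Field r" by (auto simp: underS_def intro: FieldI1)
  ultimately have F: "Field (Restr r (underS r b)) = underS r b" by (rule Refl_Field_Restr2)
  have bij: "bij_betw f UNIV (underS r b)"
    and "\<forall>m n. (m, n) \<in> natLeq \<longleftrightarrow> (f m, f n) \<in> Restr r (underS r b)"
    using f unfolding iso_iff2 F Field_natLeq by blast+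
  then have le: "m \<le> n \<longleftrightarrow> (f m, f n) \<in> r \<and> f m \<in> underS r b \<and> f n \<in> underS r b" for m n
    by (simp add: natLeq_def)
  define s where "s c = t (the_inv f c)" for c
  have inj: "inj f" and ran: "underS r b = range f" using bij by (auto simp: bij_betw_def)
  have s: "s (f n) = t n" for n using inj by (simp add: s_def the_inv_f_f)
  show ?thesis
  proof (rule miller_tree_limit[OF T b(1) _ u])
    show "underS r b \<noteq> {}" using ran by blast
    show "\<forall>c\<in>underS r b. splitting_node r T (s c)" using ran s t by auto
    show "\<forall>c\<in>underS r b. \<forall>e\<in>underS r b. (c, e) \<in> r \<longrightarrow> s c \<subseteq>\<^sub>m s e"
      using ran s le chain_map_le[of t, OF chain] by auto
    show "Map.graph u = (\<Union>c\<in>underS r b. Map.graph (s c))" using g ran s by auto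
  qed
qed

section \<open>Deciding a tree against a family of trees\<close>

definition compatible_trees :: "'a rel \<Rightarrow> ('a \<rightharpoonup> 'a) set \<Rightarrow> ('a \<rightharpoonup> 'a) set \<Rightarrow> bool" where
  "compatible_trees r S T \<longleftrightarrow> (\<exists>R. miller_tree r R \<and> R \<subseteq> S \<and> R \<subseteq> T)"

lemma ex_splitting_node:
  assumes "miller_tree r T"
  shows "\<exists>t. splitting_node r T t"
  using assms unfolding miller_tree_def seq_tree_def by blast

text \<open>A counterexample gives descending trees, the one at stage \<open>Suc n\<close> inside
  \<open>S (z n)\<close>, with increasing splitting nodes. The limit node splits in all of them, so
  it has large overlaps with infinitely many \<open>S (z n)\<close>, against
  \<open>fin\<close>.\<close>

lemma ex_decided_subtree:
  assumes r: "Card_order r" "natLeq <o r" "natLeq <o cofinality r"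
    and T: "miller_tree r T"
    and fin: "\<And>u. splitting_node r T u \<Longrightarrow>
      finite {z \<in> Z. splitting_node r (S z) u \<and> |succs r (S z) u \<inter> succs r T u| =o r}"
  shows "\<exists>R. miller_tree r R \<and> R \<subseteq> T \<and> (\<forall>z\<in>Z. R \<subseteq> S z \<or> \<not> compatible_trees r R (S z))"
proof (rule ccontr)
  assume "\<not> ?thesis"
  then have ex: "\<exists>z\<in>Z. \<not> R \<subseteq> S z \<and> compatible_trees r R (S z)" if "miller_tree r R" "R \<subseteq> T" for R
    using that by blast
  have W: "Well_order r" using r(1) card_order_on_well_order_on by blast
  have inf: "infinite (Field r)" using infinite_Field[OF r(1,2)] .
  define P where "P x \<longleftrightarrow> miller_tree r (fst x) \<and> fst x \<subseteq> T \<and> splitting_node r (fst x) (snd x)"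
    for x :: "('a \<rightharpoonup> 'a) set \<times> ('a \<rightharpoonup> 'a)"
  \<comment> \<open>The clause \<open>\<not> fst x \<subseteq> S z\<close> makes the indices
    distinct: all later trees lie inside \<open>S z\<close>, so \<open>z\<close> cannot be chosen
    again.\<close>
  define Q where "Q x z y \<longleftrightarrow> z \<in> Z \<and> fst y \<subseteq> fst x \<and> fst y \<subseteq> S z \<and> \<not> fst x \<subseteq> S z \<and> snd x \<subseteq>\<^sub>m snd y"
    for x y :: "('a \<rightharpoonup> 'a) set \<times> ('a \<rightharpoonup> 'a)" and z
  have "\<exists>f. \<forall>n::nat. P (f n) \<and> (\<exists>z. Q (f n) z (f (Suc n)))"
  proof (rule dependent_nat_choice)
    obtain t where "splitting_node r T t" using ex_splitting_node[OF T] by blast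
    then show "\<exists>x. P x" using T by (intro exI[of _ "(T, t)"]) (simp add: P_def)
  next
    fix x :: "('a \<rightharpoonup> 'a) set \<times> ('a \<rightharpoonup> 'a)"
    assume x: "P x"
    \<comment> \<open>Refining the cone rather than the tree forces the next splitting node to
      extend the current one.\<close>
    let ?C = "cone (fst x) (snd x)"
    have m: "miller_tree r (fst x)" "snd x \<in> fst x" using x by (auto simp: P_def splitting_node_def)
    have C: "miller_tree r ?C" using miller_tree_cone[OF r(1) inf m] .
    have Cx: "?C \<subseteq> fst x" by (auto simp: cone_def)
    then have "?C \<subseteq> T" using x by (auto simp: P_def)
    then obtain z where z: "z \<in> Z" "\<not> ?C \<subseteq> S z" "compatible_trees r ?C (S z)" using ex[OF C] by blast
    then obtain R where R: "miller_tree r R" "R \<subseteq> ?C" "R \<subseteq> S z" by (auto simp: compatible_trees_def)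
    obtain t where t: "splitting_node r R t" using ex_splitting_node[OF R(1)] by blast
    have "splitting_node r ?C t" using splitting_node_mono[OF r(1) inf t R(2)] .
    then have "snd x \<subseteq>\<^sub>m t" using splitting_node_cone_above[OF r(1) inf m] by blast
    then have "P (R, t) \<and> Q x z (R, t)"
      using R t z Cx \<open>?C \<subseteq> T\<close> by (auto simp: P_def Q_def)
    then show "\<exists>y. P y \<and> (\<exists>z. Q x z y)" by blast
  qed
  then obtain f where f: "\<And>n. P (f n)" "\<And>n. \<exists>z. Q (f n) z (f (Suc n))" by blast
  then obtain z where Q: "\<And>n. Q (f n) (z n) (f (Suc n))" by metis
  have decr: "fst (f n) \<subseteq> fst (f m)" if "m \<le> n" for m n
    using lift_Suc_antimono_le[of "\<lambda>n. fst (f n)", OF _ that] Q by (simp add: Q_def)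
  define t where "t n = snd (f n)" for n
  have chain: "t n \<subseteq>\<^sub>m t (Suc n)" for n using Q[of n] by (simp add: Q_def t_def)
  have tT: "t n \<in> seqs r" for n
    using f(1)[of n] seq_tree_subset[of r "fst (f n)"] by (auto simp: P_def splitting_node_def t_def)
  obtain u where u: "u \<in> seqs r" "Map.graph u = (\<Union>n. Map.graph (t n))"
    using ex_chain_limit[of r t, OF r(1) inf r(3) tT chain] by blast
  \<comment> \<open>From stage \<open>m\<close> on, all nodes of the chain split in the
    \<open>m\<close>-th tree, and this tail has the same union.\<close>
  have us: "splitting_node r (fst (f m)) u" for m
  proof (rule splitting_node_chain_limit[OF W r(2) _ _ _ u(1)])
    show "miller_tree r (fst (f m))" using f(1)[of m] by (simp add: P_def)
    show "splitting_node r (fst (f m)) (t (n + m))" for n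
    proof -
      have "splitting_node r (fst (f (n + m))) (t (n + m))" using f(1)[of "n + m"] by (simp add: P_def t_def)
      then show ?thesis using splitting_node_mono[OF r(1) inf] decr[of m "n + m"] by simp
    qed
    show "t (n + m) \<subseteq>\<^sub>m t (Suc n + m)" for n using chain by simp
    have "Map.graph (t n) \<subseteq> Map.graph (t (n + m))" for n
      using chain_map_le[of t n "n + m", OF chain] by (simp add: map_le_iff_graph)
    then show "Map.graph u = (\<Union>n. Map.graph (t (n + m)))" unfolding u(2) by blast
  qed
  let ?B = "{z \<in> Z. splitting_node r (S z) u \<and> |succs r (S z) u \<inter> succs r T u| =o r}"
  have fT: "fst (f n) \<subseteq> T" for n using f(1)[of n] by (simp add: P_def)
  have "z n \<in> ?B" for n
  proof -
    have sub: "fst (f (Suc n)) \<subseteq> S (z n)" "z n \<in> Z" using Q[of n] by (auto simp: Q_def)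
    have "succs r (fst (f (Suc n))) u \<subseteq> succs r (S (z n)) u \<inter> succs r T u"
      using succs_mono[OF sub(1)] succs_mono[OF fT] by blast
    moreover have "|succs r (fst (f (Suc n))) u| =o r" using us by (simp add: splitting_node_iff)
    moreover have "succs r (S (z n)) u \<inter> succs r T u \<subseteq> Field r" using succs_subset_Field[of r T u] by blast
    ultimately have "|succs r (S (z n)) u \<inter> succs r T u| =o r" using card_between[OF r(1)] by blast
    then show ?thesis using sub splitting_node_mono[OF r(1) inf us sub(1)] by simp
  qed
  moreover have "inj z"
  proof (rule injI)
    have "z m \<noteq> z n" if "m < n" for m n
    proof -
      have "fst (f n) \<subseteq> S (z m)" using decr[of "Suc m" n] Q[of m] that by (auto simp: Q_def)
      then show ?thesis using Q[of n] by (auto simp: Q_def)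
    qed
    then show "m = n" if "z m = z n" for m n using that by (metis nat_neq_iff)
  qed
  moreover have "finite ?B" using fin splitting_node_mono[OF r(1) inf us fT] by blast
  ultimately show False by (meson finite_imageD finite_subset image_subsetI infinite_UNIV_nat)
qed

text \<open>Miller trees are subsets of \<open>seqs r\<close>, so \<open>pow\<close> bounds their
  number by \<open>2^r\<close>; pairing with an element of \<open>2^r\<close> does not exceed this
  bound. Repetitions in the enumeration are harmless.\<close>

lemma ex_enumeration:
  assumes r: "Card_order r" and pow: "ctwo ^c |seqs r| =o ctwo ^c r"
    and inf: "infinite (Field (ctwo ^c r))" and ne: "\<exists>T. miller_tree r T"
  shows "\<exists>e. e ` Field (ctwo ^c r) = {T. miller_tree r T} \<times> Field (ctwo ^c r)"
proof -
  let ?L = "ctwo ^c r"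
  have "{T. miller_tree r T} \<subseteq> Pow (seqs r)" using seq_tree_subset by blast
  then have "|{T. miller_tree r T}| \<le>o |Pow (seqs r)|" by (rule card_of_mono1)
  also have "|Pow (seqs r)| =o ctwo ^c |seqs r|"
    unfolding ctwo_def cexp_def Field_card_of by (rule card_of_Pow_Func)
  also note pow
  finally have M: "|{T. miller_tree r T}| \<le>o ?L" .
  have "|Field ?L| \<le>o ?L"
    using card_of_Field_ordIso[OF Card_order_cexp] ordIso_imp_ordLeq by blast
  then have "|{T. miller_tree r T} \<times> Field ?L| \<le>o ?L"
    using card_of_Times_ordLeq_infinite_Field[OF inf M _ Card_order_cexp] by blast
  also have "?L =o |Field ?L|"
    using card_of_Field_ordIso[OF Card_order_cexp] ordIso_symmetric by blast
  finally have le: "|{T. miller_tree r T} \<times> Field ?L| \<le>o |Field ?L|" .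
  have "{T. miller_tree r T} \<times> Field ?L \<noteq> {}" using ne inf by auto
  then show ?thesis using le by (rule card_of_ordLeq2[THEN iffD2])
qed

section \<open>Almost disjoint and mutually decided families of trees\<close>

text \<open>\<open>almost_disjoint_refinement\<close> is applied at each node \<open>s\<close>
  separately, to the successor sets at \<open>s\<close> of all trees at once. After thinning, these
  refined sets are the successor sets.\<close>

lemma ex_thinned_trees:
  fixes L :: "'l rel" and r :: "'a rel"
  assumes r: "Card_order r" "infinite (Field r)" and L: "Card_order L" "infinite (Field L)"
    and col: "collapses_to_omega (subset_forcing r) L"
    and T: "\<And>\<xi>. \<xi> \<in> Field L \<Longrightarrow> miller_tree r (T \<xi>)"
  shows "\<exists>S. \<forall>\<xi>\<in>Field L. miller_tree r (S \<xi>) \<and> S \<xi> \<subseteq> T \<xi> \<and> (\<forall>u. splitting_node r (S \<xi>) u \<longrightarrow>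
    finite {\<zeta> \<in> underS L \<xi>. splitting_node r (S \<zeta>) u \<and> |succs r (S \<zeta>) u \<inter> succs r (S \<xi>) u| =o r})"
proof -
  \<comment> \<open>\<open>Field r\<close> is a default for trees that do not split at
    \<open>s\<close>, so that every member of the family has size \<open>r\<close>.\<close>
  define a where "a s \<xi> = (if splitting_node r (T \<xi>) s then succs r (T \<xi>) s else Field r)" for s \<xi>
  have a: "a s \<xi> \<subseteq> Field r \<and> |a s \<xi>| =o r" for s \<xi>
    using card_of_Field_ordIso[OF r(1)] by (auto simp: a_def splitting_node_iff succs_def)
  have "\<forall>s. \<exists>d. \<forall>\<xi>\<in>Field L. d \<xi> \<subseteq> a s \<xi> \<and> |d \<xi>| =o r \<and> finite {\<zeta> \<in> underS L \<xi>. |d \<zeta> \<inter> d \<xi>| =o r}"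
    by (intro allI almost_disjoint_refinement[OF r(1) L col] a)
  from choice[OF this] obtain D where D: "\<And>s \<xi>. \<xi> \<in> Field L \<Longrightarrow> D s \<xi> \<subseteq> a s \<xi>"
    "\<And>s \<xi>. \<xi> \<in> Field L \<Longrightarrow> |D s \<xi>| =o r"
    "\<And>s \<xi>. \<xi> \<in> Field L \<Longrightarrow> finite {\<zeta> \<in> underS L \<xi>. |D s \<zeta> \<inter> D s \<xi>| =o r}" by blast
  define S where "S \<xi> = thin r (T \<xi>) (\<lambda>s. D s \<xi>)" for \<xi>
  have DT: "D s \<xi> \<subseteq> succs r (T \<xi>) s" if "\<xi> \<in> Field L" "splitting_node r (T \<xi>) s" for s \<xi>
    using D(1)[of \<xi> s] that by (simp add: a_def)
  have S: "miller_tree r (S \<xi>)" if "\<xi> \<in> Field L" for \<xi>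
    unfolding S_def
    by (rule miller_tree_thin[OF r T[OF that]]) (use DT[OF that] D(2)[OF that] in blast)
  have ST: "S \<xi> \<subseteq> T \<xi>" for \<xi> unfolding S_def by (rule thin_subset[OF r])
  have succs_S: "succs r (S \<xi>) u = D u \<xi>" if "\<xi> \<in> Field L" "splitting_node r (S \<xi>) u" for \<xi> u
  proof -
    have "splitting_node r (T \<xi>) u" using splitting_node_mono[OF r that(2) ST] .
    moreover have "u \<in> S \<xi>" using that(2) by (simp add: splitting_node_def)
    ultimately show ?thesis
      unfolding S_def using succs_thin[OF r T[OF that(1)], of "\<lambda>s. D s \<xi>" u] DT that(1) by blast
  qed
  have "finite {\<zeta> \<in> underS L \<xi>. splitting_node r (S \<zeta>) u \<and> |succs r (S \<zeta>) u \<inter> succs r (S \<xi>) u| =o r}"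
    if \<xi>: "\<xi> \<in> Field L" and u: "splitting_node r (S \<xi>) u" for \<xi> u
  proof (rule finite_subset[OF _ D(3)[OF \<xi>, of u]], rule Collect_mono, rule impI, elim conjE, rule conjI)
    fix \<zeta> assume \<zeta>: "\<zeta> \<in> underS L \<xi>" "splitting_node r (S \<zeta>) u"
      and c: "|succs r (S \<zeta>) u \<inter> succs r (S \<xi>) u| =o r"
    have "\<zeta> \<in> Field L" using \<zeta> by (auto simp: underS_def intro: FieldI1)
    then show "|D u \<zeta> \<inter> D u \<xi>| =o r" using c succs_S \<xi> u \<zeta>(2) by simp
  qed
  then show ?thesis using S ST by blast
qed

text \<open>Well-founded recursion along \<open>L\<close>: each thinned tree is decided against the
  trees already chosen. The finiteness required by \<open>ex_decided_subtree\<close> survives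
  because the chosen trees are subtrees of the thinned ones.\<close>

lemma ex_decided_trees:
  fixes L :: "'l rel" and r :: "'a rel"
  assumes r: "Card_order r" "natLeq <o r" "natLeq <o cofinality r"
    and L: "Card_order L" "infinite (Field L)"
    and col: "collapses_to_omega (subset_forcing r) L"
    and T: "\<And>\<xi>. \<xi> \<in> Field L \<Longrightarrow> miller_tree r (T \<xi>)"
  shows "\<exists>R. \<forall>\<xi>\<in>Field L. miller_tree r (R \<xi>) \<and> R \<xi> \<subseteq> T \<xi> \<and>
    finite {\<zeta> \<in> underS L \<xi>. R \<xi> \<subseteq> R \<zeta>} \<and>
    (\<forall>\<zeta>\<in>underS L \<xi>. R \<xi> \<subseteq> R \<zeta> \<or> \<not> compatible_trees r (R \<xi>) (R \<zeta>))"
proof -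
  have inf: "infinite (Field r)" using infinite_Field[OF r(1,2)] .
  have W: "Well_order L" using L(1) card_order_on_well_order_on by blast
  obtain S where *: "\<forall>\<xi>\<in>Field L. miller_tree r (S \<xi>) \<and> S \<xi> \<subseteq> T \<xi> \<and> (\<forall>u. splitting_node r (S \<xi>) u \<longrightarrow>
      finite {\<zeta> \<in> underS L \<xi>. splitting_node r (S \<zeta>) u \<and> |succs r (S \<zeta>) u \<inter> succs r (S \<xi>) u| =o r})"
    using ex_thinned_trees[OF r(1) inf L col, of T, OF T] ..
  then have S: "miller_tree r (S \<xi>)" "S \<xi> \<subseteq> T \<xi>" if "\<xi> \<in> Field L" for \<xi>
    using that by simp_all
  have fin: "finite {\<zeta> \<in> underS L \<xi>. splitting_node r (S \<zeta>) u \<and> |succs r (S \<zeta>) u \<inter> succs r (S \<xi>) u| =o r}"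
    if "\<xi> \<in> Field L" "splitting_node r (S \<xi>) u" for \<xi> u
    using * that by blast
  \<comment> \<open>Replacing the earlier trees by subtrees can only shrink the overlaps.\<close>
  have fin': "finite {\<zeta> \<in> underS L \<xi>. splitting_node r (f \<zeta>) u \<and> |succs r (f \<zeta>) u \<inter> succs r (S \<xi>) u| =o r}"
    if \<xi>: "\<xi> \<in> Field L" and u: "splitting_node r (S \<xi>) u" and f: "\<And>\<zeta>. \<zeta> \<in> underS L \<xi> \<Longrightarrow> f \<zeta> \<subseteq> S \<zeta>" for \<xi> u f
  proof (rule finite_subset[OF _ fin[OF \<xi> u]], rule Collect_mono, rule impI, elim conjE, intro conjI)
    fix \<zeta> assume \<zeta>: "\<zeta> \<in> underS L \<xi>" "splitting_node r (f \<zeta>) u"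
      and c: "|succs r (f \<zeta>) u \<inter> succs r (S \<xi>) u| =o r"
    show "splitting_node r (S \<zeta>) u" using splitting_node_mono[OF r(1) inf \<zeta>(2) f[OF \<zeta>(1)]] .
    show "|succs r (S \<zeta>) u \<inter> succs r (S \<xi>) u| =o r"
    proof (rule card_between[OF r(1) c])
      show "succs r (f \<zeta>) u \<inter> succs r (S \<xi>) u \<subseteq> succs r (S \<zeta>) u \<inter> succs r (S \<xi>) u"
        using succs_mono[OF f[OF \<zeta>(1)]] by blast
      show "succs r (S \<zeta>) u \<inter> succs r (S \<xi>) u \<subseteq> Field r" by (auto simp: succs_def)
    qed
  qed
  define P where "P f \<xi> R \<longleftrightarrow> (\<xi> \<in> Field L \<longrightarrow> miller_tree r R \<and> R \<subseteq> S \<xi> \<and>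
      (\<forall>\<zeta>\<in>underS L \<xi>. R \<subseteq> f \<zeta> \<or> \<not> compatible_trees r R (f \<zeta>)))"
    for f :: "'l \<Rightarrow> ('a \<rightharpoonup> 'a) set" and \<xi> R
  have "\<exists>f. \<forall>\<xi>. P f \<xi> (f \<xi>)"
  proof (rule dependent_wf_choice[of "L - Id"])
    show "wf (L - Id)" using W by (simp add: well_order_on_def)
  next
    fix f g :: "'l \<Rightarrow> ('a \<rightharpoonup> 'a) set" and \<xi> x
    assume "\<And>z. (z, \<xi>) \<in> L - Id \<Longrightarrow> f z = g z"
    then have "\<And>z. z \<in> underS L \<xi> \<Longrightarrow> f z = g z" by (auto simp: underS_def)
    then show "P f \<xi> x = P g \<xi> x" by (simp add: P_def)
  next
    fix \<xi> and f :: "'l \<Rightarrow> ('a \<rightharpoonup> 'a) set"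
    assume IH: "\<And>z. (z, \<xi>) \<in> L - Id \<Longrightarrow> P f z (f z)"
    have sub: "f \<zeta> \<subseteq> S \<zeta>" if "\<zeta> \<in> underS L \<xi>" for \<zeta>
      using IH[of \<zeta>] that by (auto simp: P_def underS_def intro: FieldI1)
    show "\<exists>R. P f \<xi> R"
    proof (cases "\<xi> \<in> Field L")
      case True
      show ?thesis
        using ex_decided_subtree[OF r S(1)[OF True], of "underS L \<xi>" f] fin'[OF True _ sub]
        by (simp add: P_def)
    qed (simp add: P_def)
  qed
  then obtain R where R: "\<And>\<xi>. P R \<xi> (R \<xi>)" by blast
  have RS: "miller_tree r (R \<xi>)" "R \<xi> \<subseteq> S \<xi>"
    and dec: "\<And>\<zeta>. \<zeta> \<in> underS L \<xi> \<Longrightarrow> R \<xi> \<subseteq> R \<zeta> \<or> \<not> compatible_trees r (R \<xi>) (R \<zeta>)"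
    if "\<xi> \<in> Field L" for \<xi>
    using R[of \<xi>] that by (auto simp: P_def)
  have "finite {\<zeta> \<in> underS L \<xi>. R \<xi> \<subseteq> R \<zeta>}" if \<xi>: "\<xi> \<in> Field L" for \<xi>
  proof -
    \<comment> \<open>One splitting node suffices: if \<open>R \<xi> \<subseteq> R \<zeta>\<close>,
      all successors of \<open>u\<close> in \<open>R \<xi>\<close> lie in the overlap at
      \<open>u\<close>.\<close>
    obtain u where u: "splitting_node r (R \<xi>) u" using ex_splitting_node[OF RS(1)[OF \<xi>]] by blast
    have "R \<zeta> \<subseteq> S \<zeta>" if "\<zeta> \<in> underS L \<xi>" for \<zeta>
      using RS(2)[of \<zeta>] that by (auto simp: underS_def intro: FieldI1)
    then have "finite {\<zeta> \<in> underS L \<xi>. splitting_node r (R \<zeta>) u \<and> |succs r (R \<zeta>) u \<inter> succs r (S \<xi>) u| =o r}"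
      using fin'[OF \<xi> splitting_node_mono[OF r(1) inf u RS(2)[OF \<xi>]]] by blast
    then show ?thesis
    proof (rule finite_subset[rotated], intro Collect_mono impI, elim conjE, intro conjI)
      fix \<zeta> assume sub: "R \<xi> \<subseteq> R \<zeta>"
      show "splitting_node r (R \<zeta>) u" using splitting_node_mono[OF r(1) inf u sub] .
      have "|succs r (R \<xi>) u| =o r" using u by (simp add: splitting_node_iff)
      then show "|succs r (R \<zeta>) u \<inter> succs r (S \<xi>) u| =o r"
      proof (rule card_between[OF r(1)])
        show "succs r (R \<xi>) u \<subseteq> succs r (R \<zeta>) u \<inter> succs r (S \<xi>) u"
          using succs_mono[OF sub] succs_mono[OF RS(2)[OF \<xi>]] by blast
        show "succs r (R \<zeta>) u \<inter> succs r (S \<xi>) u \<subseteq> Field r" by (auto simp: succs_def)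
      qed
    qed
  qed
  moreover have "R \<xi> \<subseteq> T \<xi>" if "\<xi> \<in> Field L" for \<xi> using RS(2)[OF that] S(2)[OF that] by blast
  ultimately show ?thesis using RS(1) dec by blast
qed

theorem theorem3p13:
  fixes \<kappa> :: "'a rel"
  assumes "Card_order \<kappa>"
    and "natLeq <o \<kappa>"
    and "collapses_to_omega (subset_forcing \<kappa>) (ctwo ^c \<kappa>)"
    and "natLeq <o cofinality \<kappa>"
    and "ctwo ^c |seqs \<kappa>| =o ctwo ^c \<kappa>"
  shows "collapses_to_omega (miller_forcing \<kappa>) (ctwo ^c \<kappa>)"
proof -
  let ?L = "ctwo ^c \<kappa>"
  have inf: "infinite (Field \<kappa>)" using infinite_Field[OF assms(1,2)] .
  have L: "Card_order ?L" by (rule Card_order_cexp)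
  have "natLeq <o ?L" using assms(2) ordLess_ctwo_cexp[OF assms(1)] ordLess_transitive by blast
  then have infL: "infinite (Field ?L)" using infinite_Field[OF L] by blast
  have F: "forcing_order (miller_forcing \<kappa>)" using forcing_order_miller_forcing[OF assms(1) inf] .
  then have "miller_tree \<kappa> (seqs \<kappa>)" by (simp add: forcing_order_def miller_forcing_def)
  \<comment> \<open>Listing every pair of a tree and a label lets every label be attached to a tree
    below any given condition.\<close>
  then obtain e where e: "e ` Field ?L = {T. miller_tree \<kappa> T} \<times> Field ?L"
    using ex_enumeration[OF assms(1,5) infL] by blast
  have e1: "miller_tree \<kappa> (fst (e \<xi>))" "snd (e \<xi>) \<in> Field ?L" if "\<xi> \<in> Field ?L" for \<xi>
  proof -
    have "e \<xi> \<in> {T. miller_tree \<kappa> T} \<times> Field ?L" using e that by blast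
    then show "miller_tree \<kappa> (fst (e \<xi>))" "snd (e \<xi>) \<in> Field ?L" by auto
  qed
  obtain R where *: "\<forall>\<xi>\<in>Field ?L. miller_tree \<kappa> (R \<xi>) \<and> R \<xi> \<subseteq> fst (e \<xi>) \<and>
      finite {\<zeta> \<in> underS ?L \<xi>. R \<xi> \<subseteq> R \<zeta>} \<and>
      (\<forall>\<zeta>\<in>underS ?L \<xi>. R \<xi> \<subseteq> R \<zeta> \<or> \<not> compatible_trees \<kappa> (R \<xi>) (R \<zeta>))"
    using ex_decided_trees[OF assms(1,2,4) L infL assms(3), of "\<lambda>\<xi>. fst (e \<xi>)", OF e1(1)] ..
  then have R: "miller_tree \<kappa> (R \<xi>)" "R \<xi> \<subseteq> fst (e \<xi>)"
    and fin: "finite {\<zeta> \<in> underS ?L \<xi>. R \<xi> \<subseteq> R \<zeta>}" if "\<xi> \<in> Field ?L" for \<xi>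
    using that by simp_all
  have dec: "R \<xi> \<subseteq> R \<zeta> \<or> \<not> compatible_trees \<kappa> (R \<xi>) (R \<zeta>)"
    if "\<xi> \<in> Field ?L" "\<zeta> \<in> underS ?L \<xi>" for \<xi> \<zeta>
    using * that by blast
  define m where "m \<xi> = card {\<zeta> \<in> underS ?L \<xi>. R \<xi> \<subseteq> R \<zeta>}" for \<xi>
  \<comment> \<open>Compatibility gives \<open>R \<xi> \<subseteq> R \<zeta>\<close>. So everything
    counted for \<open>\<zeta>\<close> is counted for \<open>\<xi>\<close>, and
    \<open>\<zeta>\<close> itself is counted in addition.\<close>
  have m_less: "m \<zeta> < m \<xi>" if \<xi>: "\<xi> \<in> Field ?L" and \<zeta>: "\<zeta> \<in> underS ?L \<xi>"
    and c: "compatible_trees \<kappa> (R \<xi>) (R \<zeta>)" for \<xi> \<zeta>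
  proof -
    have sub: "R \<xi> \<subseteq> R \<zeta>" using dec[OF \<xi> \<zeta>] c by blast
    have "\<zeta> \<notin> {\<eta> \<in> underS ?L \<zeta>. R \<zeta> \<subseteq> R \<eta>}" by (simp add: underS_def)
    moreover have "\<zeta> \<in> {\<eta> \<in> underS ?L \<xi>. R \<xi> \<subseteq> R \<eta>}" using \<zeta> sub by simp
    moreover have "{\<eta> \<in> underS ?L \<zeta>. R \<zeta> \<subseteq> R \<eta>} \<subseteq> {\<eta> \<in> underS ?L \<xi>. R \<xi> \<subseteq> R \<eta>}"
      using underS_trans[OF L infL _ \<zeta>] sub by auto
    ultimately show ?thesis unfolding m_def by (intro psubset_card_mono fin[OF \<xi>]) blast
  qed
  have "forces_equinumerous (miller_forcing \<kappa>) (Field ?L) (UNIV :: nat set) (weakest (miller_forcing \<kappa>))"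
  proof (rule forces_equinumerous_natI[where I = "Field ?L" and q = R and lab = "\<lambda>\<xi>. snd (e \<xi>)" and m = m])
    show "forcing_order (miller_forcing \<kappa>)" "infinite (Field ?L)" by fact+
    show "\<And>\<xi>. \<xi> \<in> Field ?L \<Longrightarrow> R \<xi> \<in> conds (miller_forcing \<kappa>)" using R(1) by (simp add: miller_forcing_def)
    show "\<And>\<xi>. \<xi> \<in> Field ?L \<Longrightarrow> snd (e \<xi>) \<in> Field ?L" by (rule e1(2))
  next
    fix i j p
    assume ij: "i \<in> Field ?L" "j \<in> Field ?L" "m i = m j" and "p \<in> conds (miller_forcing \<kappa>)"
      "weaker (miller_forcing \<kappa>) (R i) p" "weaker (miller_forcing \<kappa>) (R j) p"
    then have "miller_tree \<kappa> p" "p \<subseteq> R i" "p \<subseteq> R j" by (simp_all add: miller_forcing_def)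
    then have "compatible_trees \<kappa> (R i) (R j)" "compatible_trees \<kappa> (R j) (R i)"
      unfolding compatible_trees_def by blast+
    \<comment> \<open>Compatible trees with different indices have different values of
      \<open>m\<close>, so two of them with the same value coincide.\<close>
    then have "i = j" using underS_total[OF L infL ij(1,2)] m_less[of j i] m_less[of i j] ij by auto
    then show "snd (e i) = snd (e j)" by simp
  next
    \<comment> \<open>For the index \<open>\<xi>\<close> that lists \<open>(p, x)\<close>, the tree
      \<open>R \<xi>\<close> is a subtree of \<open>p\<close> and carries the label
      \<open>x\<close>.\<close>
    fix p x assume p: "p \<in> conds (miller_forcing \<kappa>)" and x: "x \<in> Field ?L"
    then have "(p, x) \<in> e ` Field ?L" unfolding e by (simp add: miller_forcing_def)
    then obtain \<xi> where "\<xi> \<in> Field ?L" "e \<xi> = (p, x)" by (metis imageE)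
    then show "\<exists>i\<in>Field ?L. snd (e i) = x \<and> weaker (miller_forcing \<kappa>) p (R i)"
      using R(2)[of \<xi>] by (intro bexI[of _ \<xi>]) (simp_all add: miller_forcing_def)
  qed
  then show ?thesis by (simp add: collapses_to_omega_def)
qed

end
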